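(* Let $p$ be a prime number, and let $n,m$ be integers such that $n>1$ and $0\leq m\leq n-2$. (a) The link of an $m$-simplex in $X(\mathbb{F}_p^n)$ is homotopy equivalent to the wedge of $A_{m,n}(p)$ spheres $S^{n-m-2}$, where $$A_{m,n}(p)=(-1)^{n-m-1}+\sum_{i=0}^{n-m-2}(-1)^{n-m-i}\frac{(p^n-p^{m+1})\cdots(p^n-p^{m+i+1})}{(i+1)!}.$$ (b) The link of an $m$-simplex in $K(\mathbb{F}_p^n)$ is homotopy equivalent to the wedge of $B_{m,n}(p)$ spheres $S^{n-m-2}$, where $$B_{m,n}(p)=(-1)^{n-m-1}+\sum_{i=0}^{n-m-2}(-1)^{n-m-i}\frac{(p^n-p^{m+1})\cdots(p^n-p^{m+i+1})}{(p-1)^{i+1}(i+1)!}.$$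
   Context: $X(\mathbb{F}_p^n)$ is the simplicial complex whose vertices are the nonzero vectors of $\mathbb{F}_p^n$ and whose simplices are the linearly independent (unimodular) subsets of $\mathbb{F}_p^n$. $K(\mathbb{F}_p^n)$ is the simplicial complex whose vertices are the one-dimensional subspaces (lines) of $\mathbb{F}_p^n$ and whose $m$-simplices are the sets of $m+1$ lines spanning an $(m+1)$-dimensional subspace. An $m$-simplex has $m+1$ vertices. The link of $\sigma$ in $K$ is $\mathrm{Lk}_K(\sigma)=\{\tau : \sigma\cup\tau\in K,\ \sigma\cap\tau=\emptyset\}$. The product $(p^n-p^{m+1})\cdots(p^n-p^{m+i+1})$ means $\prod_{j=m+1}^{m+i+1}(p^n-p^j)$. *)

theory Defs
  imports "HOL-Analysis.Analysis" "HOL-Computational_Algebra.Primes"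
begin

text \<open>
  An abstract simplicial complex is represented by its set of simplices. The empty simplex is
  allowed (with this link it is always in the link of a simplex); it contributes no point to the
  geometric realization, since barycentric coordinates sum to 1.
\<close>

definition link :: "'v set set \<Rightarrow> 'v set \<Rightarrow> 'v set set" where
  "link K \<sigma> = {\<tau>. \<sigma> \<union> \<tau> \<in> K \<and> \<sigma> \<inter> \<tau> = {}}"

text \<open>
  Barycentric coordinates. The vertex type is finite, so the complex is finite and the topology
  induced from the product topology on functions is the usual (weak) topology.
\<close>

definition geometric_realization :: "'v::finite set set \<Rightarrow> ('v \<Rightarrow> real) topology" where
  "geometric_realization K =
     top_of_set {x. (\<forall>v. 0 \<le> x v) \<and> (\<Sum>v\<in>UNIV. x v) = 1 \<and> {v. x v \<noteq> 0} \<in> K}"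

definition unimodular_complex :: "('a::field ^ 'n) set set" where
  "unimodular_complex = {S. finite S \<and> vec.independent S}"

definition lines :: "('a::field ^ 'n) set set" where
  "lines = {L. vec.subspace L \<and> vec.dim L = 1}"

definition line_complex :: "('a::field ^ 'n) set set set" where
  "line_complex = {S. finite S \<and> S \<subseteq> lines \<and> vec.dim (vec.span (\<Union>S)) = card S}"

text \<open>
  The wedge of the pointed spaces \<open>(X i, b i)\<close>, \<open>i \<in> I\<close>: the quotient of their disjoint union by
  identifying all base points. The common base point is \<open>None\<close>, which is present
  even for empty \<open>I\<close>, so that the empty wedge is a point.
\<close>

definition wedge_proj :: "('i \<Rightarrow> 'a) \<Rightarrow> 'i \<times> 'a \<Rightarrow> ('i \<times> 'a) option" where
  "wedge_proj b z = (if snd z = b (fst z) then None else Some z)"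

definition wedge :: "('i \<Rightarrow> 'a topology) \<Rightarrow> ('i \<Rightarrow> 'a) \<Rightarrow> 'i set \<Rightarrow> ('i \<times> 'a) option topology" where
  "wedge X b I = topology (\<lambda>U.
     U \<subseteq> insert None (wedge_proj b ` topspace (sum_topology X I)) \<and>
     openin (sum_topology X I) {z \<in> topspace (sum_topology X I). wedge_proj b z \<in> U})"

lemma openin_wedge:
  "openin (wedge X b I) U \<longleftrightarrow>
     U \<subseteq> insert None (wedge_proj b ` topspace (sum_topology X I)) \<and>
     openin (sum_topology X I) {z \<in> topspace (sum_topology X I). wedge_proj b z \<in> U}"
proof -
  let ?S = "sum_topology X I"
  let ?T = "insert None (wedge_proj b ` topspace ?S)"
  let ?pre = "\<lambda>U. {z \<in> topspace ?S. wedge_proj b z \<in> U}"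
  have "istopology (\<lambda>U. U \<subseteq> ?T \<and> openin ?S (?pre U))"
    unfolding istopology_def
  proof (intro conjI allI impI)
    fix U V assume *: "U \<subseteq> ?T \<and> openin ?S (?pre U)" "V \<subseteq> ?T \<and> openin ?S (?pre V)"
    then show "U \<inter> V \<subseteq> ?T" by (meson Int_lower1 subset_trans)
    have "openin ?S (?pre U \<inter> ?pre V)" using * by (intro openin_Int) simp_all
    moreover have "?pre (U \<inter> V) = ?pre U \<inter> ?pre V" by blast
    ultimately show "openin ?S (?pre (U \<inter> V))" by simp
  next
    fix \<U> assume *: "\<forall>U\<in>\<U>. U \<subseteq> ?T \<and> openin ?S (?pre U)"
    then show "\<Union>\<U> \<subseteq> ?T" by (intro Union_least) simp
    have "openin ?S (\<Union>(?pre ` \<U>))" using * by (intro openin_Union) (erule imageE, simp)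
    moreover have "?pre (\<Union>\<U>) = \<Union>(?pre ` \<U>)" by (intro set_eqI) simp
    ultimately show "openin ?S (?pre (\<Union>\<U>))" by simp
  qed
  then show ?thesis
    unfolding wedge_def by (simp add: topology_inverse')
qed

lemma topspace_wedge:
  "topspace (wedge X b I) = insert None (wedge_proj b ` topspace (sum_topology X I))"
proof (rule subset_antisym)
  let ?S = "sum_topology X I"
  let ?T = "insert None (wedge_proj b ` topspace ?S)"
  show "topspace (wedge X b I) \<subseteq> ?T"
    using openin_topspace[of "wedge X b I"] unfolding openin_wedge by (rule conjunct1)
  have "{z \<in> topspace ?S. wedge_proj b z \<in> ?T} = topspace ?S"
    by blast
  then have "openin (wedge X b I) ?T"
    unfolding openin_wedge by (metis openin_topspace order_refl)
  then show "?T \<subseteq> topspace (wedge X b I)"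
    by (rule openin_subset)
qed

lemma quotient_map_wedge:
  assumes "I \<noteq> {}" and "\<And>i. i \<in> I \<Longrightarrow> b i \<in> topspace (X i)"
  shows "quotient_map (sum_topology X I) (wedge X b I) (wedge_proj b)"
proof -
  from assms obtain i where "(i, b i) \<in> topspace (sum_topology X I)" by auto
  then have "None \<in> wedge_proj b ` topspace (sum_topology X I)"
    by (rule rev_image_eqI) (simp add: wedge_proj_def)
  then show ?thesis
    unfolding quotient_map_def topspace_wedge openin_wedge
    by (simp only: insert_absorb) simp
qed

definition sphere_basepoint :: "nat \<Rightarrow> real" where
  "sphere_basepoint = (\<lambda>i. if i = 0 then 1 else 0)"

definition wedge_of_spheres :: "nat \<Rightarrow> nat \<Rightarrow> (nat \<times> (nat \<Rightarrow> real)) option topology" where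
  "wedge_of_spheres N d = wedge (\<lambda>_. nsphere d) (\<lambda>_. sphere_basepoint) {..<N}"

definition A_number :: "nat \<Rightarrow> nat \<Rightarrow> nat \<Rightarrow> real" where
  "A_number m n p = (-1) ^ (n - m - 1) +
     (\<Sum>i = 0..n - m - 2. (-1) ^ (n - m - i) *
        ((\<Prod>j = m + 1..m + i + 1. real p ^ n - real p ^ j) / fact (i + 1)))"

definition B_number :: "nat \<Rightarrow> nat \<Rightarrow> nat \<Rightarrow> real" where
  "B_number m n p = (-1) ^ (n - m - 1) +
     (\<Sum>i = 0..n - m - 2. (-1) ^ (n - m - i) *
        ((\<Prod>j = m + 1..m + i + 1. real p ^ n - real p ^ j) /
         ((real p - 1) ^ (i + 1) * fact (i + 1))))"

end

theory Submission
  imports Defs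
begin

text \<open>
  Both links are independence complexes of matroids: independent sets of vectors form a matroid,
  so do independent families of lines, and the link of a face of a matroid complex is the
  complex of the contracted matroid. A matroid complex \<open>K\<close> of rank \<open>d + 1\<close> is a
  wedge of \<open>d\<close>-spheres for the following reason.

  Deletion and contraction of an element \<open>e\<close> produce, by induction, a set \<open>H\<close> of bases such
  that \<open>K - H\<close> collapses to a point (\<open>matroid_collapsible_diff_bases\<close>). When \<open>e\<close> lies in every
  basis, \<open>K\<close> is a cone and \<open>H\<close> is empty. Otherwise \<open>K\<close> arises from the deletion by attaching
  a cone over the contraction, and bases removed from either part give the bases to remove from
  \<open>K\<close>. The elements of \<open>H\<close> are simplices of top dimension \<open>d\<close> and \<open>K - H\<close> contains their whole
  boundaries, so shrinking the contractible subcomplex \<open>K - H\<close> to a point turns every simplex of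
  \<open>H\<close> into a sphere and \<open>K\<close> into a wedge of \<open>card H\<close> spheres
  (\<open>complex_minus_contractible_wedge\<close>).

  Geometrically, three explicit maps do the work. An elementary collapse is realised by a
  straight-line deformation (\<open>elementary_collapse_homotopy_equivalent\<close>). The contraction of
  \<open>K - H\<close> is extended to all of \<open>K\<close> through collars of the simplices in \<open>H\<close>
  (\<open>contract_subcomplex_extends\<close>). Finally \<open>simplex_chart\<close> maps a simplex onto the sphere by
  inverse stereographic projection, sending the boundary to the base point.

  The number of spheres is read off from the Euler characteristic. Each collapse removes two faces
  of adjacent dimensions, so the alternating sum of the face numbers of \<open>K\<close>, empty face included,
  is \<open>\<plusminus> card H\<close>. The face numbers follow from the number of ways to extend an
  independent set of size \<open>k\<close>, which is \<open>p ^ n - p ^ k\<close> for vectors and that number divided by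
  \<open>p - 1\<close> for lines (\<open>card_faces\<close>, \<open>link_wedge_of_spheres\<close>).
\<close>

section \<open>Collapsible families of faces\<close>

definition down_closed :: "'v set set \<Rightarrow> bool" where
  "down_closed K \<longleftrightarrow> (\<forall>\<tau>\<in>K. \<forall>\<rho>. \<rho> \<subseteq> \<tau> \<longrightarrow> \<rho> \<in> K)"

lemma down_closedD: "down_closed K \<Longrightarrow> \<tau> \<in> K \<Longrightarrow> \<rho> \<subseteq> \<tau> \<Longrightarrow> \<rho> \<in> K"
  by (auto simp: down_closed_def)

text \<open>
  The empty face takes part in collapses: the last step of a collapse to a vertex \<open>w\<close> removes the
  pair \<open>{}\<close>, \<open>{w}\<close>, so the induction can end with the empty family. This makes cones over collapses
  uniform, since the pair \<open>{}\<close>, \<open>{w}\<close> of the base becomes the pair \<open>{e}\<close>, \<open>{e, w}\<close> of the cone.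
\<close>

inductive collapsible :: "'v set set \<Rightarrow> bool" where
  empty: "collapsible {}"
| collapse: "\<lbrakk>\<sigma> \<in> K; insert w \<sigma> \<in> K; w \<notin> \<sigma>;
     \<And>\<rho>. \<rho> \<in> K \<Longrightarrow> \<sigma> \<subseteq> \<rho> \<Longrightarrow> \<rho> = \<sigma> \<or> \<rho> = insert w \<sigma>;
     collapsible (K - {\<sigma>, insert w \<sigma>})\<rbrakk> \<Longrightarrow> collapsible K"

text \<open>
  The faces are matched in pairs \<open>\<sigma>\<close>, \<open>insert e \<sigma>\<close>. A face \<open>\<sigma>\<close> that is maximal among those
  avoiding \<open>e\<close> has no coface besides its partner, so its pair can be removed, and what remains is
  again a cone.
\<close>

lemma collapsible_cone:
  fixes K :: "'v::finite set set"
  assumes "\<And>\<tau>. \<tau> \<in> K \<Longrightarrow> insert e \<tau> \<in> K \<and> \<tau> - {e} \<in> K"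
  shows "collapsible K"
proof -
  have "finite K" by simp
  then show ?thesis using assms
  proof (induction K rule: finite_psubset_induct)
    case (psubset K)
    note cone = psubset.prems
    show ?case
    proof (cases "K = {}")
      case True
      then show ?thesis by (simp add: collapsible.empty)
    next
      case False
      let ?D = "{\<tau> \<in> K. e \<notin> \<tau>}"
      have "?D \<noteq> {}" using False cone by fastforce
      then obtain \<sigma> where \<sigma>: "\<sigma> \<in> ?D" and max: "\<And>\<tau>. \<tau> \<in> ?D \<Longrightarrow> \<sigma> \<subseteq> \<tau> \<Longrightarrow> \<tau> = \<sigma>"
        using finite_has_maximal[of ?D] by auto
      have e: "insert e \<sigma> \<in> K" "e \<notin> \<sigma>" using cone \<sigma> by auto
      have coface: "\<rho> = \<sigma> \<or> \<rho> = insert e \<sigma>" if "\<rho> \<in> K" "\<sigma> \<subseteq> \<rho>" for \<rho>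
      proof -
        have "\<rho> - {e} = \<sigma>" using max[of "\<rho> - {e}"] cone that e by auto
        then show ?thesis by auto
      qed
      have "insert e \<tau> \<in> K - {\<sigma>, insert e \<sigma>} \<and> \<tau> - {e} \<in> K - {\<sigma>, insert e \<sigma>}"
        if "\<tau> \<in> K - {\<sigma>, insert e \<sigma>}" for \<tau>
        using that cone[of \<tau>] e by auto
      then have "collapsible (K - {\<sigma>, insert e \<sigma>})"
        using psubset.IH[of "K - {\<sigma>, insert e \<sigma>}"] \<sigma> by blast
      then show ?thesis
        using \<sigma> e coface by (intro collapsible.collapse[of \<sigma> K e]) auto
    qed
  qed
qed

text \<open>
  A collapse of \<open>L\<close> at \<open>\<sigma>\<close> lifts to one at \<open>insert e \<sigma>\<close>, because every coface of the latter
  contains \<open>e\<close> and hence comes from \<open>L\<close>. Performing all of them removes the faces through \<open>e\<close>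
  and leaves \<open>D\<close>.
\<close>

lemma collapsible_attach_cone:
  assumes "collapsible L" "collapsible D"
    and "\<And>\<tau>. \<tau> \<in> L \<Longrightarrow> e \<notin> \<tau>" and "\<And>\<tau>. \<tau> \<in> D \<Longrightarrow> e \<notin> \<tau>"
  shows "collapsible (D \<union> insert e ` L)"
  using assms(1,3)
proof (induction L)
  case empty
  then show ?case using assms(2) by simp
next
  case (collapse \<sigma> L w)
  let ?K = "D \<union> insert e ` L"
  have *: "?K - {insert e \<sigma>, insert w (insert e \<sigma>)} = D \<union> insert e ` (L - {\<sigma>, insert w \<sigma>})"
  proof -
    have inj: "inj_on (insert e) L" 
      by (rule inj_onI) (metis collapse.prems insert_ident)
    have "insert e ` (L - {\<sigma>, insert w \<sigma>}) = insert e ` L - insert e ` {\<sigma>, insert w \<sigma>}"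
      using collapse.hyps by (intro inj_on_image_set_diff[OF inj]) auto
    moreover have "insert e \<sigma> \<notin> D" "insert e (insert w \<sigma>) \<notin> D" using assms(4) by auto
    ultimately show ?thesis by (auto simp: insert_commute)
  qed
  show ?case
  proof (rule collapsible.collapse[of "insert e \<sigma>" _ w])
    show "insert e \<sigma> \<in> ?K" using collapse.hyps by simp
    have "insert e (insert w \<sigma>) \<in> ?K" using collapse.hyps by simp
    then show "insert w (insert e \<sigma>) \<in> ?K" by (simp add: insert_commute)
    show "w \<notin> insert e \<sigma>" using collapse.hyps collapse.prems by auto
    show "collapsible (?K - {insert e \<sigma>, insert w (insert e \<sigma>)})"
      unfolding * using collapse.IH collapse.prems by blast
    fix \<rho> assume \<rho>: "\<rho> \<in> ?K" "insert e \<sigma> \<subseteq> \<rho>"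
    then obtain \<tau> where \<tau>: "\<tau> \<in> L" "\<rho> = insert e \<tau>" using assms(4) by auto
    then have "\<sigma> \<subseteq> \<tau>" using \<rho> collapse.hyps collapse.prems by blast
    then have "\<tau> = \<sigma> \<or> \<tau> = insert w \<sigma>" using collapse.hyps \<tau> by blast
    then show "\<rho> = insert e \<sigma> \<or> \<rho> = insert w (insert e \<sigma>)"
      using \<tau> by (auto simp: insert_commute)
  qed
qed

text \<open>
  The two faces removed by a collapse contribute opposite signs.
\<close>

lemma collapsible_euler:
  fixes K :: "'v::finite set set"
  assumes "collapsible K"
  shows "(\<Sum>\<sigma>\<in>K. (-1) ^ card \<sigma>) = (0 :: real)"
  using assms
proof (induction K)
  case empty
  then show ?case by simp
next
  case (collapse \<sigma> K w)
  have "(\<Sum>\<sigma>\<in>K. (-1) ^ card \<sigma>) = (\<Sum>\<sigma>\<in>K - {\<sigma>, insert w \<sigma>}. (-1) ^ card \<sigma>)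
      + (\<Sum>\<sigma>\<in>{\<sigma>, insert w \<sigma>}. (-1) ^ card \<sigma> :: real)"
    using collapse.hyps by (intro sum.subset_diff) auto
  also have "(\<Sum>\<sigma>\<in>{\<sigma>, insert w \<sigma>}. (-1) ^ card \<sigma> :: real) = 0"
    using \<open>w \<notin> \<sigma>\<close> by (subst sum.insert) auto
  finally show ?case using collapse.IH by simp
qed

section \<open>Matroid complexes are collapsible up to bases\<close>

definition matroid :: "'v set set \<Rightarrow> bool" where
  "matroid K \<longleftrightarrow> {} \<in> K \<and> down_closed K \<and>
     (\<forall>A\<in>K. \<forall>B\<in>K. card A < card B \<longrightarrow> (\<exists>x\<in>B - A. insert x A \<in> K))"

lemma matroid_augment:
  assumes "matroid K" "A \<in> K" "B \<in> K" "card A < card B"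
  obtains x where "x \<in> B" "x \<notin> A" "insert x A \<in> K"
  using assms by (auto simp: matroid_def)

lemma matroid_extend_to_rank:
  fixes K :: "'v::finite set set"
  assumes K: "matroid K" and A: "A \<in> K" and B: "B \<in> K" "card A \<le> card B"
  obtains C where "C \<in> K" "A \<subseteq> C" "card C = card B"
proof -
  have "\<exists>C\<in>K. A \<subseteq> C \<and> card C = card B"
    using A B(2)
  proof (induction "card B - card A" arbitrary: A)
    case 0
    then show ?case by auto
  next
    case (Suc k)
    then have "card A < card B" by simp
    then obtain x where x: "x \<in> B" "x \<notin> A" "insert x A \<in> K"
      using matroid_augment[OF K Suc.prems(1) B(1)] by blast
    have "card (insert x A) = Suc (card A)" using x by simp
    then have "\<exists>C\<in>K. insert x A \<subseteq> C \<and> card C = card B"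
      using Suc x by (intro Suc.hyps(1)) auto
    then show ?case by auto
  qed
  then show ?thesis using that by blast
qed

text \<open>
  Deletion and contraction. For an element \<open>e\<close> let \<open>D\<close> be the faces that avoid \<open>e\<close> and \<open>L\<close> the
  link of \<open>e\<close>. If some basis avoids \<open>e\<close>, then \<open>D\<close> has the same rank as \<open>K\<close> and \<open>L\<close> has rank one
  less. The bases chosen in \<open>L\<close>, enlarged by \<open>e\<close>, are again bases of \<open>K\<close>, and together with those
  chosen in \<open>D\<close> they form \<open>H\<close>; the rest is the rest of \<open>D\<close> with a cone over the rest of \<open>L\<close>
  attached. In rank 0 the only face is the empty one, and \<open>H\<close> consists of it.
\<close>

theorem matroid_collapsible_diff_bases:
  fixes K :: "'v::finite set set"
  assumes "matroid K" "B \<in> K" "card B = r" "\<And>\<tau>. \<tau> \<in> K \<Longrightarrow> card \<tau> \<le> r"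
  shows "\<exists>H\<subseteq>K. (\<forall>h\<in>H. card h = r) \<and> collapsible (K - H)"
  using assms
proof (induction "card (\<Union>K)" arbitrary: K B r rule: less_induct)
  case less
  note K = \<open>matroid K\<close>
  have down: "\<And>\<tau> \<rho>. \<tau> \<in> K \<Longrightarrow> \<rho> \<subseteq> \<tau> \<Longrightarrow> \<rho> \<in> K" and "{} \<in> K"
    using K by (auto simp: matroid_def down_closed_def)
  show ?case
  proof (cases "\<Union>K = {}")
    case True
    then have "K = {{}}" using \<open>{} \<in> K\<close> by auto
    then show ?thesis using less.prems collapsible.empty by (intro exI[of _ K]) auto
  next
    case False
    then obtain e \<tau>0 where "\<tau>0 \<in> K" "e \<in> \<tau>0" by auto
    then have eK: "{e} \<in> K" using down by auto
    define D where "D = {\<tau> \<in> K. e \<notin> \<tau>}"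
    define L where "L = {\<tau>. e \<notin> \<tau> \<and> insert e \<tau> \<in> K}"
    have KDL: "K = D \<union> insert e ` L"
    proof -
      have "\<tau> \<in> insert e ` L" if "\<tau> \<in> K" "e \<in> \<tau>" for \<tau>
        using that by (intro image_eqI[of _ _ "\<tau> - {e}"]) (auto simp: L_def insert_absorb)
      then show ?thesis by (auto simp: D_def L_def)
    qed
    show ?thesis
    proof (cases "\<exists>C\<in>D. card C = r")
      case False
      \<comment> \<open>Every basis contains \<open>e\<close>, so the complex is a cone with apex \<open>e\<close>.\<close>
      have "insert e \<tau> \<in> K" if \<tau>: "\<tau> \<in> K" for \<tau>
      proof -
        obtain C where C: "C \<in> K" "\<tau> \<subseteq> C" "card C = r"
          using matroid_extend_to_rank[OF K \<tau> \<open>B \<in> K\<close>] less.prems(3,4) \<tau> by metis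
        then have "e \<in> C" using False by (auto simp: D_def)
        then show ?thesis using C down[of C "insert e \<tau>"] by auto
      qed
      then have "collapsible K" using down by (intro collapsible_cone[of K e]) auto
      then show ?thesis by (intro exI[of _ "{}"]) auto
    next
      case True
      then obtain C where C: "C \<in> D" "card C = r" by blast
      have e_union: "e \<notin> \<Union>D" "e \<notin> \<Union>L" "e \<in> \<Union>K" using eK by (auto simp: D_def L_def)
      have sub: "\<Union>D \<subseteq> \<Union>K" "\<Union>L \<subseteq> \<Union>K" by (auto simp: D_def L_def)
      have less_D: "card (\<Union>D) < card (\<Union>K)"
      proof (rule psubset_card_mono)
        show "\<Union>D \<subset> \<Union>K" using e_union sub by blast
      qed simp
      have less_L: "card (\<Union>L) < card (\<Union>K)"
      proof (rule psubset_card_mono)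
        show "\<Union>L \<subset> \<Union>K" using e_union sub by blast
      qed simp
      have "matroid D"
        unfolding matroid_def down_closed_def
      proof (intro conjI ballI impI allI)
        fix X Y assume "X \<in> D" "Y \<in> D" "card X < card Y"
        then obtain x where "x \<in> Y" "x \<notin> X" "insert x X \<in> K"
          using matroid_augment[OF K, of X Y] by (auto simp: D_def)
        then show "\<exists>x\<in>Y - X. insert x X \<in> D" using \<open>X \<in> D\<close> \<open>Y \<in> D\<close> by (auto simp: D_def)
      qed (use down \<open>{} \<in> K\<close> in \<open>auto simp: D_def\<close>)
      then obtain HD where HD: "HD \<subseteq> D" "\<forall>h\<in>HD. card h = r" "collapsible (D - HD)"
        using less.hyps[OF less_D _ C] less.prems(4) D_def by auto
      have "matroid L"
        unfolding matroid_def down_closed_def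
      proof (intro conjI ballI impI allI)
        show "{} \<in> L" using eK by (simp add: L_def)
      next
        fix X Y assume "X \<in> L" "Y \<subseteq> X"
        then show "Y \<in> L" using down[of "insert e X" "insert e Y"] by (auto simp: L_def)
      next
        fix X Y assume XY: "X \<in> L" "Y \<in> L" "card X < card Y"
        then have "card (insert e X) < card (insert e Y)" by (simp add: L_def)
        then obtain x where "x \<in> insert e Y" "x \<notin> insert e X" "insert x (insert e X) \<in> K"
          using matroid_augment[OF K, of "insert e X" "insert e Y"] XY by (auto simp: L_def)
        then show "\<exists>x\<in>Y - X. insert x X \<in> L"
          using XY by (auto simp: L_def insert_commute)
      qed
      moreover obtain E where E: "E \<in> K" "{e} \<subseteq> E" "card E = r"
        using matroid_extend_to_rank[OF K eK \<open>B \<in> K\<close>] less.prems(3,4) eK by metis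
      moreover have "E - {e} \<in> L" using E by (auto simp: L_def insert_absorb)
      moreover have "card (E - {e}) = r - 1" "r > 0" using E by (auto simp: card_gt_0_iff)
      moreover have "card \<tau> \<le> r - 1" if "\<tau> \<in> L" for \<tau>
        using less.prems(4)[of "insert e \<tau>"] that by (auto simp: L_def)
      ultimately obtain HL where HL: "HL \<subseteq> L" "\<forall>h\<in>HL. card h = r - 1" "collapsible (L - HL)"
        using less.hyps[OF less_L, of "E - {e}" "r - 1"] by metis
      let ?H = "HD \<union> insert e ` HL"
      have inj: "inj_on (insert e) L"
        by (rule inj_onI) (auto simp: L_def insert_ident)
      have "K - ?H = (D - HD) \<union> insert e ` (L - HL)"
      proof -
        have "insert e ` (L - HL) = insert e ` L - insert e ` HL"
          using HL by (intro inj_on_image_set_diff[OF inj]) auto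
        moreover have "\<tau> \<notin> D" if "e \<in> \<tau>" for \<tau> using that by (auto simp: D_def)
        ultimately show ?thesis using HD(1) unfolding KDL by auto
      qed
      moreover have "collapsible \<dots>"
        using HD HL by (intro collapsible_attach_cone) (auto simp: D_def L_def)
      moreover have "?H \<subseteq> K" using HD HL unfolding KDL by auto
      moreover have "card h = r" if "h \<in> ?H" for h
        using that HD(2) HL(1,2) \<open>r > 0\<close> by (auto simp: L_def)
      ultimately show ?thesis by (intro exI[of _ ?H]) auto
    qed
  qed
qed

text \<open>
  The alternating sum of face numbers vanishes on the collapsible part, so it only sees the removed
  bases, which all have the same sign.
\<close>

lemma card_removed_bases:
  fixes K H :: "'v::finite set set"
  assumes H: "H \<subseteq> K" "\<forall>h\<in>H. card h = r" and coll: "collapsible (K - H)"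
    and r: "\<And>\<tau>. \<tau> \<in> K \<Longrightarrow> card \<tau> \<le> r"
  shows "real (card H) = (\<Sum>k\<le>r. (-1) ^ (r + k) * real (card {\<tau> \<in> K. card \<tau> = k}))"
proof -
  have "(\<Sum>\<sigma>\<in>K. (-1) ^ card \<sigma>) = (\<Sum>\<sigma>\<in>K - H. (-1) ^ card \<sigma>) + (\<Sum>\<sigma>\<in>H. (-1) ^ card \<sigma> :: real)"
    using H by (intro sum.subset_diff) auto
  also have "\<dots> = (-1) ^ r * real (card H)" using H collapsible_euler[OF coll] by simp
  finally have "(-1) ^ r * (\<Sum>\<sigma>\<in>K. (-1) ^ card \<sigma>) = real (card H)"
    by (simp flip: power_add mult.assoc)
  moreover have "(\<Sum>\<sigma>\<in>K. (-1) ^ card \<sigma> :: real)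
      = (\<Sum>k\<le>r. (-1) ^ k * real (card {\<tau> \<in> K. card \<tau> = k}))"
  proof -
    have "(\<Sum>\<sigma>\<in>K. (-1) ^ card \<sigma> :: real)
        = (\<Sum>k\<le>r. \<Sum>\<sigma>\<in>{\<tau> \<in> K. card \<tau> = k}. (-1) ^ card \<sigma>)"
      using r by (intro sum.group[symmetric]) auto
    also have "\<dots> = (\<Sum>k\<le>r. (-1) ^ k * real (card {\<tau> \<in> K. card \<tau> = k}))"
      by (intro sum.cong) auto
    finally show ?thesis .
  qed
  ultimately have "real (card H)
      = (-1) ^ r * (\<Sum>k\<le>r. (-1) ^ k * real (card {\<tau> \<in> K. card \<tau> = k}))"
    by (simp only:)
  then show ?thesis by (simp only: sum_distrib_left power_add mult.assoc)
qed

section \<open>Elementary collapses are homotopy equivalences\<close>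

definition polyhedron :: "'v::finite set set \<Rightarrow> ('v \<Rightarrow> real) set" where
  "polyhedron K = {x. (\<forall>v. 0 \<le> x v) \<and> (\<Sum>v\<in>UNIV. x v) = 1 \<and> {v. x v \<noteq> 0} \<in> K}"

lemma geometric_realization_eq: "geometric_realization K = top_of_set (polyhedron K)"
  by (simp add: geometric_realization_def polyhedron_def)

lemma continuous_on_Min_image:
  fixes f :: "'i \<Rightarrow> 'a::topological_space \<Rightarrow> real"
  assumes "finite A" "A \<noteq> {}" "\<And>a. a \<in> A \<Longrightarrow> continuous_on S (f a)"
  shows "continuous_on S (\<lambda>x. Min ((\<lambda>a. f a x) ` A))"
  using assms
proof (induction A rule: finite_ne_induct)
  case (singleton a)
  then show ?case by simp
next
  case (insert a A)
  have "(\<lambda>x. Min ((\<lambda>a. f a x) ` insert a A)) = (\<lambda>x. min (f a x) (Min ((\<lambda>a. f a x) ` A)))"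
    using insert.hyps by auto
  then show ?case using insert by (auto intro!: continuous_intros)
qed

lemma continuous_on_coord [continuous_intros]: "continuous_on S (\<lambda>x. x i)"
  by (rule continuous_on_product_then_coordinatewise[OF continuous_on_id])

lemma continuous_on_snd_coord [continuous_intros]: "continuous_on S (\<lambda>p. snd p i)"
  by (rule continuous_on_product_then_coordinatewise) (intro continuous_intros)

lemma continuous_on_if_const:
  assumes "P \<Longrightarrow> continuous_on S f" "\<not> P \<Longrightarrow> continuous_on S g"
  shows "continuous_on S (\<lambda>x. if P then f x else g x)"
  using assms by (cases P) auto

lemma Min_coords_nonneg:
  fixes x :: "'v::finite \<Rightarrow> real"
  assumes "\<sigma> \<noteq> {}" "\<forall>v. 0 \<le> x v"
  shows "0 \<le> Min (x ` \<sigma>)" 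
  using assms by (subst Min_ge_iff) auto

lemma Min_coords_eq_0_iff:
  fixes x :: "'v::finite \<Rightarrow> real"
  assumes "\<sigma> \<noteq> {}" "\<forall>v. 0 \<le> x v"
  shows "Min (x ` \<sigma>) = 0 \<longleftrightarrow> \<not> \<sigma> \<subseteq> {v. x v \<noteq> 0}"
proof
  assume "Min (x ` \<sigma>) = 0"
  moreover have "Min (x ` \<sigma>) \<in> x ` \<sigma>" using assms by (intro Min_in) auto
  ultimately show "\<not> \<sigma> \<subseteq> {v. x v \<noteq> 0}" by auto
next
  assume "\<not> \<sigma> \<subseteq> {v. x v \<noteq> 0}"
  then obtain v where "v \<in> \<sigma>" "x v = 0" by auto
  then have "Min (x ` \<sigma>) \<le> 0" by (metis Min_le finite finite_imageI imageI)
  then show "Min (x ` \<sigma>) = 0" using Min_coords_nonneg[OF assms] by simp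
qed

text \<open>
  Let \<open>t\<close> be the least barycentric coordinate of a point at the vertices of \<open>\<sigma>\<close>. It is positive
  exactly on the two open cells to be removed. Subtracting \<open>t\<close> at all vertices of \<open>\<sigma>\<close> and adding
  the lost mass at \<open>w\<close> moves such a point within \<open>insert w \<sigma>\<close> until some vertex of \<open>\<sigma>\<close> is lost
  from its support, and fixes every other point. Since \<open>t\<close> is continuous on the whole complex, the
  straight-line homotopy is a deformation retraction.
\<close>

lemma elementary_collapse_homotopy_equivalent:
  fixes K :: "'v::finite set set"
  assumes K: "down_closed K" and \<sigma>: "\<sigma> \<in> K" "insert w \<sigma> \<in> K" "w \<notin> \<sigma>" "\<sigma> \<noteq> {}"
    and coface: "\<And>\<rho>. \<rho> \<in> K \<Longrightarrow> \<sigma> \<subseteq> \<rho> \<Longrightarrow> \<rho> = \<sigma> \<or> \<rho> = insert w \<sigma>"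
  shows "top_of_set (polyhedron K) homotopy_equivalent_space
           top_of_set (polyhedron (K - {\<sigma>, insert w \<sigma>}))"
proof -
  let ?K' = "K - {\<sigma>, insert w \<sigma>}"
  define t :: "('v \<Rightarrow> real) \<Rightarrow> real" where "t x = Min (x ` \<sigma>)" for x
  define h :: "real \<times> ('v \<Rightarrow> real) \<Rightarrow> 'v \<Rightarrow> real" where
    "h = (\<lambda>(s, x) v. x v - (if v \<in> \<sigma> then s * t x else 0)
                         + (if v = w then real (card \<sigma>) * (s * t x) else 0))"
  have cont_t: "continuous_on S (\<lambda>p. t (snd p))" for S :: "(real \<times> ('v \<Rightarrow> real)) set"
    unfolding t_def using \<sigma>(4) by (intro continuous_on_Min_image continuous_intros) auto
  have cont_h: "continuous_on S h" for S
    unfolding h_def case_prod_unfold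
    by (intro continuous_on_coordinatewise_then_product continuous_on_if_const
        continuous_intros cont_t)
  have h_in: "h (s, x) \<in> polyhedron K" and h1_in: "s = 1 \<Longrightarrow> h (s, x) \<in> polyhedron ?K'"
    and h_fix: "{v. x v \<noteq> 0} \<in> ?K' \<Longrightarrow> h (s, x) = x"
    if x: "x \<in> polyhedron K" and s: "s \<in> {0..1}" for x s
  proof -
    from x have x0: "\<forall>v. 0 \<le> x v" and x1: "(\<Sum>v\<in>UNIV. x v) = 1" and xK: "{v. x v \<noteq> 0} \<in> K"
      by (auto simp: polyhedron_def)
    have t0: "0 \<le> t x" and t_eq: "t x = 0 \<longleftrightarrow> \<not> \<sigma> \<subseteq> {v. x v \<noteq> 0}"
      unfolding t_def using Min_coords_nonneg[OF \<sigma>(4) x0] Min_coords_eq_0_iff[OF \<sigma>(4) x0] by auto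
    have t_le: "t x \<le> x v" if "v \<in> \<sigma>" for v unfolding t_def using that by auto
    have st: "s * t x \<le> t x" "0 \<le> s * t x" using s t0 mult_right_mono[of s 1 "t x"] by auto
    have nonneg: "\<forall>v. 0 \<le> h (s, x) v"
      unfolding h_def using x0 st t_le by (force simp: add_increasing2)
    have "(\<Sum>v\<in>UNIV. h (s, x) v) = (\<Sum>v\<in>UNIV. x v) - (\<Sum>v\<in>UNIV. if v \<in> \<sigma> then s * t x else 0)
       + (\<Sum>v\<in>UNIV. if v = w then real (card \<sigma>) * (s * t x) else 0)"
      unfolding h_def by (simp add: sum.distrib sum_subtractf)
    also have "\<dots> = 1" using x1 by (simp add: sum.If_cases)
    finally have sum1: "(\<Sum>v\<in>UNIV. h (s, x) v) = 1" .
    show fixed: "h (s, x) = x" if "{v. x v \<noteq> 0} \<in> ?K'"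
    proof -
      have "t x = 0" using that coface t_eq by auto
      then show ?thesis by (auto simp: h_def fun_eq_iff)
    qed
    show "h (s, x) \<in> polyhedron K"
    proof (cases "t x = 0")
      case True
      then have "h (s, x) = x" by (auto simp: h_def fun_eq_iff)
      then show ?thesis using x by simp
    next
      case False
      then have "{v. x v \<noteq> 0} \<subseteq> insert w \<sigma>" using t_eq coface xK by blast
      then have "{v. h (s, x) v \<noteq> 0} \<subseteq> insert w \<sigma>" by (auto simp: h_def split: if_splits)
      then show ?thesis using nonneg sum1 down_closedD[OF K \<sigma>(2)] by (simp add: polyhedron_def)
    qed
    then have hK: "{v. h (s, x) v \<noteq> 0} \<in> K" by (simp add: polyhedron_def)
    show "h (s, x) \<in> polyhedron ?K'" if "s = 1"
    proof -
      have "t x \<in> x ` \<sigma>" unfolding t_def using \<sigma>(4) by (intro Min_in) auto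
      then obtain v where v: "v \<in> \<sigma>" "x v = t x" by auto
      then have "h (s, x) v = 0" using \<sigma>(3) that by (auto simp: h_def)
      then have "{v. h (s, x) v \<noteq> 0} \<in> ?K'" using v(1) hK by auto
      then show ?thesis using nonneg sum1 by (simp add: polyhedron_def)
    qed
  qed
  have sub: "polyhedron ?K' \<subseteq> polyhedron K" by (auto simp: polyhedron_def)
  have "homotopic_with_canon (\<lambda>x. True) (polyhedron K) (polyhedron K) id (id \<circ> (\<lambda>x. h (1, x)))"
    unfolding homotopic_with_def
  proof (intro exI[of _ h] conjI)
    have "continuous_on ({0..1} \<times> polyhedron K) h" by (rule cont_h)
    then show "continuous_map (prod_topology (top_of_set {0..1}) (top_of_set (polyhedron K)))
        (top_of_set (polyhedron K)) h"
      using h_in by (auto simp: prod_topology_subtopology_eu)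
  qed (auto simp: h_def fun_eq_iff)
  moreover have "retraction_maps (top_of_set (polyhedron K)) (top_of_set (polyhedron ?K'))
      (\<lambda>x. h (1, x)) id"
    unfolding retraction_maps_def
  proof (intro conjI)
    have "continuous_on (polyhedron K) (\<lambda>x. h (1, x))"
      by (rule continuous_on_compose2[OF cont_h[of UNIV]]) (auto intro!: continuous_intros)
    then show "continuous_map (top_of_set (polyhedron K)) (top_of_set (polyhedron ?K')) (\<lambda>x. h (1, x))"
      using h1_in by auto
    show "continuous_map (top_of_set (polyhedron ?K')) (top_of_set (polyhedron K)) id"
      using sub by auto
  qed (use h_fix sub in \<open>auto simp: polyhedron_def\<close>)
  ultimately show ?thesis
    by (intro deformation_retraction_imp_homotopy_equivalent_space) (auto simp: homotopic_with_sym)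
qed

text \<open>
  The collapse that removes the empty face can only happen when a single vertex is left; all
  earlier ones are homotopy equivalences.
\<close>

theorem collapsible_imp_contractible:
  fixes K :: "'v::finite set set"
  assumes "collapsible K" "down_closed K" "{} \<in> K"
  shows "contractible (polyhedron K)"
  using assms
proof (induction K)
  case empty
  then show ?case by simp
next
  case (collapse \<sigma> K w)
  show ?case
  proof (cases "\<sigma> = {}")
    \<comment> \<open>The empty face has no coface besides \<open>{w}\<close>, so the realization is the single point \<open>w\<close>.\<close>
    case True
    have "x = (\<lambda>v. if v = w then 1 else 0)" if "x \<in> polyhedron K" for x
    proof -
      have "{v. x v \<noteq> 0} \<subseteq> {w}" using that True collapse.hyps(4) by (force simp: polyhedron_def)
      then have 0: "x v = 0" if "v \<noteq> w" for v using that by auto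
      have "(\<Sum>v\<in>UNIV. x v) = x w" using 0 by (subst sum.remove[of _ w]) auto
      then have "x w = 1" using that by (simp add: polyhedron_def)
      then show ?thesis using 0 by auto
    qed
    then have "topspace (top_of_set (polyhedron K)) \<subseteq> {\<lambda>v. if v = w then 1 else 0}" by auto
    from contractible_space_subset_singleton[OF this] show ?thesis by simp
  next
    case False
    let ?K' = "K - {\<sigma>, insert w \<sigma>}"
    have "down_closed ?K'"
      unfolding down_closed_def
    proof (intro ballI allI impI)
      fix \<tau> \<rho> assume *: "\<tau> \<in> ?K'" "\<rho> \<subseteq> \<tau>"
      then have "\<not> \<sigma> \<subseteq> \<tau>" using collapse.hyps(4) by blast
      then show "\<rho> \<in> ?K'" using * down_closedD[OF collapse.prems(1)] by blast
    qed
    then have "contractible (polyhedron ?K')" using collapse False by simp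
    then show ?thesis
      using elementary_collapse_homotopy_equivalent[OF collapse.prems(1) collapse.hyps(1-3) False
          collapse.hyps(4)] homotopy_equivalent_space_contractibility contractible_space_top_of_set
      by blast
  qed
qed

section \<open>Shrinking a contractible subcomplex\<close>

text \<open>
  \<open>F\<close> deforms the identity of \<open>X\<close> to a map that is constant on the fibres of \<open>q\<close>. That map factors
  through \<open>q\<close> as \<open>g \<circ> q\<close>, so \<open>F\<close> itself is a homotopy from the identity to \<open>g \<circ> q\<close>. For
  the other composite, \<open>q \<circ> F\<close> descends to a homotopy \<open>G\<close> on \<open>Y\<close>; this needs that the product
  of \<open>q\<close> with the identity of the compact interval is still a quotient map.
\<close>

lemma homotopy_equivalent_quotient:
  fixes X :: "'a topology" and Y :: "'b topology"
  assumes q: "quotient_map X Y q"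
    and F: "continuous_map (prod_topology (top_of_set {0..1::real}) X) X F"
    and F0: "\<And>x. x \<in> topspace X \<Longrightarrow> F (0, x) = x"
    and F1: "\<And>x y. \<lbrakk>x \<in> topspace X; y \<in> topspace X; q x = q y\<rbrakk> \<Longrightarrow> F (1, x) = F (1, y)"
    and Fq: "\<And>s x y. \<lbrakk>s \<in> {0..1}; x \<in> topspace X; y \<in> topspace X; q x = q y\<rbrakk>
                 \<Longrightarrow> q (F (s, x)) = q (F (s, y))"
  shows "X homotopy_equivalent_space Y"
proof -
  let ?I = "top_of_set {0..1::real}"
  have cq: "continuous_map X Y q" and sq: "q ` topspace X = topspace Y"
    using q quotient_imp_continuous_map quotient_imp_surjective_map by blast+
  have "continuous_map X X (F \<circ> Pair 1)"
    by (rule continuous_map_o_Pair[OF F]) simp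
  moreover have "(F \<circ> Pair 1) x = (F \<circ> Pair 1) y"
    if "x \<in> topspace X" "y \<in> topspace X" "q x = q y" for x y
    unfolding comp_apply using that by (rule F1)
  ultimately have "\<exists>g. continuous_map Y X g \<and> (\<forall>x\<in>topspace X. g (q x) = (F \<circ> Pair 1) x)"
    by (rule quotient_map_lift_exists[OF q]) blast+
  then obtain g where g: "continuous_map Y X g" and gq: "\<And>x. x \<in> topspace X \<Longrightarrow> g (q x) = F (1, x)"
    by auto
  have Q: "quotient_map (prod_topology ?I X) (prod_topology ?I Y) (\<lambda>(s, x). (s, q x))"
  proof (rule quotient_map_prod_right[OF _ _ q])
    show "locally_compact_space ?I"
      by (intro compact_imp_locally_compact_space) (simp add: compact_space_subtopology)
    show "Hausdorff_space ?I \<or> regular_space ?I"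
      by (simp add: Hausdorff_space_subtopology)
  qed
  have "continuous_map (prod_topology ?I X) Y (q \<circ> F)"
    by (rule continuous_map_compose[OF F cq])
  moreover have "(q \<circ> F) p = (q \<circ> F) p'"
    if "p \<in> topspace (prod_topology ?I X)" "p' \<in> topspace (prod_topology ?I X)"
      "(case p of (s, x) \<Rightarrow> (s, q x)) = (case p' of (s, x) \<Rightarrow> (s, q x))" for p p'
    using that Fq[of "fst p" "snd p" "snd p'"] by (cases p; cases p') simp
  ultimately have "\<exists>G. continuous_map (prod_topology ?I Y) Y G \<and>
      (\<forall>p\<in>topspace (prod_topology ?I X). G (case p of (s, x) \<Rightarrow> (s, q x)) = (q \<circ> F) p)"
    by (rule quotient_map_lift_exists[OF Q]) blast+
  then obtain G where G: "continuous_map (prod_topology ?I Y) Y G"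
      and Gp: "\<forall>p\<in>topspace (prod_topology ?I X). G (case p of (s, x) \<Rightarrow> (s, q x)) = (q \<circ> F) p"
    by blast
  have G': "G (s, q x) = q (F (s, x))" if "s \<in> {0..1}" "x \<in> topspace X" for s x
    using bspec[OF Gp, of "(s, x)"] that by simp
  have "homotopic_with (\<lambda>x. True) X X id (g \<circ> q)"
  proof (subst homotopic_with, simp, intro exI[of _ F] conjI ballI TrueI F)
    show "F (0, x) = id x" "F (1, x) = (g \<circ> q) x" if "x \<in> topspace X" for x
      using F0 gq that by auto
  qed
  then have hom_gq: "homotopic_with (\<lambda>x. True) X X (g \<circ> q) id" by (rule homotopic_with_symD)
  have "homotopic_with (\<lambda>x. True) Y Y id (q \<circ> g)"
  proof (subst homotopic_with, simp, intro exI[of _ G] conjI ballI TrueI G)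
    fix y assume "y \<in> topspace Y"
    then obtain x where x: "x \<in> topspace X" "y = q x" using sq by blast
    show "G (0, y) = id y" "G (1, y) = (q \<circ> g) y" using F0 gq x G' by auto
  qed
  then have "homotopic_with (\<lambda>x. True) Y Y (q \<circ> g) id" by (rule homotopic_with_symD)
  with hom_gq show ?thesis
    unfolding homotopy_equivalent_space_def using cq g by (intro exI conjI)
qed

text \<open>
  The homotopy extension property for the pair formed by \<open>K\<close> and \<open>K - H\<close>, applied to a contraction
  \<open>c\<close> of \<open>K - H\<close>. On a simplex \<open>h\<close> in \<open>H\<close> let \<open>t h x\<close> be the radial coordinate, which is 0 on
  the boundary and 1 at the barycentre. At time \<open>s\<close> the collar \<open>t \<le> s / 2\<close> is pushed radially
  onto the boundary and then moved by \<open>c\<close> for the time \<open>s - 2 * t\<close>, while the remaining inner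
  part is expanded radially over the whole simplex. On the edge \<open>t = s / 2\<close> of the collar both
  prescriptions give the radial projection to the boundary.
\<close>

lemma contract_subcomplex_extends:
  fixes K H :: "'v::finite set set"
  assumes K: "down_closed K" and H: "H \<subseteq> K" "\<And>h. h \<in> H \<Longrightarrow> card h = d + 1"
    and dim: "\<And>\<tau>. \<tau> \<in> K \<Longrightarrow> card \<tau> \<le> d + 1"
    and contr: "contractible (polyhedron (K - H))"
  obtains F :: "real \<times> ('v \<Rightarrow> real) \<Rightarrow> 'v \<Rightarrow> real" where
    "continuous_on ({0..1} \<times> polyhedron K) F"
    "\<And>s x. s \<in> {0..1} \<Longrightarrow> x \<in> polyhedron K \<Longrightarrow> F (s, x) \<in> polyhedron K"
    "\<And>x. x \<in> polyhedron K \<Longrightarrow> F (0, x) = x"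
    "\<And>s x. s \<in> {0..1} \<Longrightarrow> x \<in> polyhedron (K - H) \<Longrightarrow> F (s, x) \<in> polyhedron (K - H)"
    "\<And>x y. x \<in> polyhedron (K - H) \<Longrightarrow> y \<in> polyhedron (K - H) \<Longrightarrow> F (1, x) = F (1, y)"
proof -
  let ?P = "polyhedron K" and ?P' = "polyhedron (K - H)"
  define n where "n = real d + 1"
  define t where "t h x = n * Min (x ` h)" for h and x :: "'v \<Rightarrow> real"
  define T where "T x = (\<Sum>h\<in>H. t h x)" for x
  define \<mu> where "\<mu> h p = min (t h (snd p)) (fst p / 2)" for h and p :: "real \<times> ('v \<Rightarrow> real)"
  \<comment> \<open>Radial expansion: remove the multiple \<open>min (t h x) (s / 2)\<close> of the barycentre of \<open>h\<close>, then rescale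
    to total mass 1. At most one summand is nonzero at any point, so one formula serves all of \<open>K\<close>.\<close>
  define Z where "Z p = (\<lambda>v. (snd p v - (\<Sum>h\<in>H. if v \<in> h then \<mu> h p / n else 0)) / (1 - (\<Sum>h\<in>H. \<mu> h p)))"
    for p :: "real \<times> ('v \<Rightarrow> real)"
  obtain a c where c: "continuous_on ({0..1::real} \<times> ?P') c" "\<And>s x. s \<in> {0..1} \<Longrightarrow> x \<in> ?P' \<Longrightarrow> c (s, x) \<in> ?P'"
    "\<And>x. c (0, x) = x" "\<And>x. c (1, x) = a"
    using contr by (fastforce simp: contractible_def homotopic_with_def prod_topology_subtopology_eu)
  have n: "0 < n" by (simp add: n_def)
  have [simp]: "min 0 (s / 2) = 0" if "0 \<le> s" for s :: real using that by simp
  have Hne: "h \<noteq> {}" if "h \<in> H" for h using H(2)[OF that] by auto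
  have x0: "\<forall>v. 0 \<le> x v" and x1: "(\<Sum>v\<in>UNIV. x v) = 1" and xK: "{v. x v \<noteq> 0} \<in> K"
    if "x \<in> ?P" for x using that by (auto simp: polyhedron_def)
  have t0: "0 \<le> t h x" if "x \<in> ?P" "h \<in> H" for x h
    unfolding t_def using Min_coords_nonneg[OF Hne x0] that n by simp
  have t_eq: "t h x = 0 \<longleftrightarrow> {v. x v \<noteq> 0} \<noteq> h" if "x \<in> ?P" "h \<in> H" for x h
  proof -
    have "card {v. x v \<noteq> 0} \<le> card h" using dim[OF xK] H(2) that by simp
    then have "h \<subseteq> {v. x v \<noteq> 0} \<longleftrightarrow> {v. x v \<noteq> 0} = h" by (metis card_seteq finite order_refl)
    then show ?thesis unfolding t_def using Min_coords_eq_0_iff[OF Hne x0] that n by simp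
  qed
  have t_le: "t h x / n \<le> x v" if "v \<in> h" for v h x
    unfolding t_def using n that by simp
  have P'_iff: "x \<in> ?P' \<longleftrightarrow> x \<in> ?P \<and> {v. x v \<noteq> 0} \<notin> H" for x
    by (auto simp: polyhedron_def)
  have sum_one: "(\<Sum>h\<in>H. f h (t h x)) = f {v. x v \<noteq> 0} (t {v. x v \<noteq> 0} x)"
    if "x \<in> ?P" "{v. x v \<noteq> 0} \<in> H" "\<And>h. f h 0 = 0" for f :: "'v set \<Rightarrow> real \<Rightarrow> real" and x
  proof -
    have "t h x = 0" if "h \<in> H - {{v. x v \<noteq> 0}}" for h
      using t_eq[OF \<open>x \<in> ?P\<close>, of h] that by blast
    then have "(\<Sum>h\<in>H - {{v. x v \<noteq> 0}}. f h (t h x)) = 0"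
      using that(3) by (intro sum.neutral) simp
    then show ?thesis using that(2) by (subst sum.remove[of _ "{v. x v \<noteq> 0}"]) auto
  qed
  have sum_none: "(\<Sum>h\<in>H. f h (t h x)) = 0" if "x \<in> ?P'" "\<And>h. f h 0 = 0"
    for f :: "'v set \<Rightarrow> real \<Rightarrow> real" and x
  proof -
    have "t h x = 0" if "h \<in> H" for h
      using t_eq[of x h] that \<open>x \<in> ?P'\<close> P'_iff by blast
    then show ?thesis using that(2) by (intro sum.neutral) simp
  qed
  have Z_P': "Z (s, x) = x \<and> T x = 0" if "x \<in> ?P'" "0 \<le> s" for s x
  proof -
    have "(\<Sum>h\<in>H. if v \<in> h then \<mu> h (s, x) / n else 0) = 0" for v
      unfolding \<mu>_def fst_conv snd_conv using that
      by (intro sum_none[where f = "\<lambda>h r. if v \<in> h then min r (s / 2) / n else 0"]) auto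
    moreover have "(\<Sum>h\<in>H. \<mu> h (s, x)) = 0"
      unfolding \<mu>_def fst_conv snd_conv using that
      by (intro sum_none[where f = "\<lambda>h r. min r (s / 2)"]) auto
    moreover have "T x = 0" using sum_none[OF that(1), of "\<lambda>h r. r"] by (simp add: T_def)
    ultimately show ?thesis by (simp add: Z_def)
  qed
  have facet: "Z (s, x) = (\<lambda>v. (x v - (if x v \<noteq> 0 then min (T x) (s / 2) / n else 0)) / (1 - min (T x) (s / 2)))"
      "T x = t {v. x v \<noteq> 0} x" "(\<Sum>h\<in>H. \<mu> h (s, x)) = min (T x) (s / 2)"
    if x: "x \<in> ?P" "{v. x v \<noteq> 0} \<in> H" "0 \<le> s" for s x
  proof -
    show T: "T x = t {v. x v \<noteq> 0} x"
      using sum_one[OF x(1,2), of "\<lambda>h r. r"] by (simp add: T_def)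
    show M: "(\<Sum>h\<in>H. \<mu> h (s, x)) = min (T x) (s / 2)"
      unfolding \<mu>_def fst_conv snd_conv T using x
      by (intro sum_one[where f = "\<lambda>h r. min r (s / 2)"]) auto
    have "(\<Sum>h\<in>H. if v \<in> h then \<mu> h (s, x) / n else 0)
        = (if x v \<noteq> 0 then min (T x) (s / 2) / n else 0)" for v
      unfolding \<mu>_def fst_conv snd_conv T
      using sum_one[OF x(1,2), where f = "\<lambda>h r. if v \<in> h then min r (s / 2) / n else 0"] x(3)
      by (simp only: mem_Collect_eq) auto
    then show "Z (s, x) = (\<lambda>v. (x v - (if x v \<noteq> 0 then min (T x) (s / 2) / n else 0)) / (1 - min (T x) (s / 2)))"
      by (simp add: Z_def M)
  qed
  have T0: "0 \<le> T x" if "x \<in> ?P" for x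
    unfolding T_def using that t0 by (intro sum_nonneg) auto
  have Z_in: "Z (s, x) \<in> ?P" and Z_in': "T x \<le> s / 2 \<Longrightarrow> Z (s, x) \<in> ?P'"
    and Z_den: "(\<Sum>h\<in>H. \<mu> h (s, x)) \<le> 1 / 2"
    if x: "x \<in> ?P" and s: "s \<in> {0..1}" for s x
  proof -
    have s0: "0 \<le> s" using s by simp
    have "Z (s, x) \<in> ?P \<and> (T x \<le> s / 2 \<longrightarrow> Z (s, x) \<in> ?P') \<and> (\<Sum>h\<in>H. \<mu> h (s, x)) \<le> 1 / 2"
    proof (cases "{v. x v \<noteq> 0} \<in> H")
      case False
      then have x': "x \<in> ?P'" using x P'_iff by simp
      have "(\<Sum>h\<in>H. \<mu> h (s, x)) = 0"
        unfolding \<mu>_def fst_conv snd_conv using x' s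
        by (intro sum_none[where f = "\<lambda>h r. min r (s / 2)"]) auto
      then show ?thesis using Z_P'[OF x' s0] x x' by simp
    next
      case True
      define h where "h = {v. x v \<noteq> 0}"
      define m where "m = min (T x) (s / 2)"
      have hH: "h \<in> H" using True by (simp add: h_def)
      note Z = facet[OF x True s0, folded m_def]
      have m: "0 \<le> m" "m \<le> 1 / 2" "m \<le> T x" using T0[OF x] s by (auto simp: m_def)
      have card_h: "real (card h) = n" using H(2)[OF hH] by (simp add: n_def)
      have "m / n \<le> x v" if "x v \<noteq> 0" for v
      proof -
        have "m / n \<le> t h x / n" using m n by (simp add: Z(2) h_def divide_right_mono)
        also have "\<dots> \<le> x v" using t_le[of v h x] that by (simp add: h_def)
        finally show ?thesis .
      qed
      then have "\<forall>v. 0 \<le> Z (s, x) v" using m x0[OF x] by (auto simp: Z(1))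
      moreover have "(\<Sum>v\<in>UNIV. Z (s, x) v) = 1"
      proof -
        have "(\<Sum>v\<in>UNIV. if x v \<noteq> 0 then m / n else 0) = real (card h) * (m / n)"
          by (simp add: sum.If_cases h_def)
        also have "\<dots> = m" using card_h n by simp
        finally have "(\<Sum>v\<in>UNIV. Z (s, x) v) = ((\<Sum>v\<in>UNIV. x v) - m) / (1 - m)"
          by (simp add: Z(1) sum_subtractf flip: sum_divide_distrib)
        then show ?thesis using x1[OF x] m by simp
      qed
      moreover have supp: "{v. Z (s, x) v \<noteq> 0} \<subseteq> h" by (auto simp: Z(1) h_def)
      ultimately have ZP: "Z (s, x) \<in> ?P"
        using down_closedD[OF K xK[OF x]] by (simp add: polyhedron_def h_def)
      moreover have "Z (s, x) \<in> ?P'" if "T x \<le> s / 2"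
      proof -
        have "m = T x" using that by (simp add: m_def)
        have "Min (x ` h) \<in> x ` h" using Hne[OF hH] by (intro Min_in) auto
        then obtain v where "Min (x ` h) = x v" and v: "v \<in> h" by (rule imageE)
        then have "x v = m / n" using n by (simp add: \<open>m = T x\<close> Z(2) t_def h_def)
        then have "Z (s, x) v = 0" using v by (simp add: Z(1) h_def)
        then have "{v. Z (s, x) v \<noteq> 0} \<subset> h" using v supp by blast
        then have "card {v. Z (s, x) v \<noteq> 0} < card h" by (intro psubset_card_mono) auto
        then show ?thesis using ZP H(2) hH P'_iff by fastforce
      qed
      ultimately show ?thesis using Z(3) m by simp
    qed
    then show "Z (s, x) \<in> ?P" "T x \<le> s / 2 \<Longrightarrow> Z (s, x) \<in> ?P'"
      "(\<Sum>h\<in>H. \<mu> h (s, x)) \<le> 1 / 2" by auto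
  qed
  have cont_t: "continuous_on S (\<lambda>p. t h (snd p))" if "h \<in> H" for h and S :: "(real \<times> ('v \<Rightarrow> real)) set"
    unfolding t_def using Hne[OF that] by (intro continuous_on_Min_image continuous_intros) auto
  have cont_T: "continuous_on S (\<lambda>p. T (snd p))" for S :: "(real \<times> ('v \<Rightarrow> real)) set"
    unfolding T_def by (intro continuous_intros cont_t)
  have cont_\<mu>: "continuous_on S (\<mu> h)" if "h \<in> H" for h S
    unfolding \<mu>_def by (intro continuous_intros cont_t that) auto
  have cont_Z: "continuous_on ({0..1} \<times> ?P) Z"
    unfolding Z_def
  proof (intro continuous_on_coordinatewise_then_product continuous_on_divide continuous_on_diff
      continuous_on_sum continuous_on_snd_coord continuous_on_const continuous_on_if_const cont_\<mu> ballI)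
    show "1 - (\<Sum>h\<in>H. \<mu> h p) \<noteq> 0" if "p \<in> {0..1} \<times> ?P" for p
      using Z_den that by fastforce
  qed (use n in auto)
  define F where "F p = (if T (snd p) - fst p / 2 \<le> 0 then c (fst p - 2 * T (snd p), Z p) else Z p)" for p
  show thesis
  proof (rule that[of F])
    show "continuous_on ({0..1} \<times> ?P) F"
      unfolding F_def
    proof (rule continuous_on_cases_le)
      have cZ: "continuous_on {p \<in> {0..1} \<times> ?P. T (snd p) - fst p / 2 \<le> 0} Z"
        by (rule continuous_on_subset[OF cont_Z]) auto
      show "continuous_on {p \<in> {0..1} \<times> ?P. T (snd p) - fst p / 2 \<le> 0}
          (\<lambda>p. c (fst p - 2 * T (snd p), Z p))"
      proof (rule continuous_on_compose2[OF c(1)])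
        show "continuous_on {p \<in> {0..1} \<times> ?P. T (snd p) - fst p / 2 \<le> 0} (\<lambda>p. (fst p - 2 * T (snd p), Z p))"
          by (intro continuous_intros cont_T cZ)
        show "(\<lambda>p. (fst p - 2 * T (snd p), Z p)) ` {p \<in> {0..1} \<times> ?P. T (snd p) - fst p / 2 \<le> 0}
            \<subseteq> {0..1} \<times> ?P'"
          using T0 Z_in' by fastforce
      qed
      show "continuous_on {p \<in> {0..1} \<times> ?P. 0 \<le> T (snd p) - fst p / 2} Z"
        by (rule continuous_on_subset[OF cont_Z]) auto
      show "continuous_on ({0..1} \<times> ?P) (\<lambda>p. T (snd p) - fst p / 2)"
        by (intro continuous_intros cont_T) auto
      show "c (fst p - 2 * T (snd p), Z p) = Z p" if "T (snd p) - fst p / 2 = 0" for p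
      proof -
        have "fst p - 2 * T (snd p) = 0" using that by simp
        then show ?thesis using c(3) by simp
      qed
    qed
    show "F (s, x) \<in> ?P" if "s \<in> {0..1}" "x \<in> ?P" for s x
    proof (cases "T x \<le> s / 2")
      case True
      then have "c (s - 2 * T x, Z (s, x)) \<in> ?P'"
        using that T0[OF that(2)] Z_in'[OF that(2,1)] by (intro c(2)) auto
      then show ?thesis using True by (simp add: F_def P'_iff)
    next
      case False
      then show ?thesis using Z_in[OF that(2,1)] by (simp add: F_def)
    qed
    show "F (0, x) = x" if "x \<in> ?P" for x
    proof -
      have "\<mu> h (0, x) = 0" if "h \<in> H" for h using t0[OF \<open>x \<in> ?P\<close> that] by (simp add: \<mu>_def)
      then have "(\<Sum>h\<in>H. if v \<in> h then \<mu> h (0, x) / n else 0) = 0" "(\<Sum>h\<in>H. \<mu> h (0, x)) = 0" for v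
        by (auto intro!: sum.neutral)
      then have "Z (0, x) = x" by (simp add: Z_def)
      then show ?thesis using T0[OF that] c(3) by (simp add: F_def)
    qed
    show "F (s, x) \<in> ?P'" if "s \<in> {0..1}" "x \<in> ?P'" for s x
      using Z_P'[OF that(2), of s] that c(2)[OF that] by (simp add: F_def)
    show "F (1, x) = F (1, y)" if "x \<in> ?P'" "y \<in> ?P'" for x y
      using Z_P'[OF that(1), of 1] Z_P'[OF that(2), of 1] c(4) by (simp add: F_def)
  qed
qed

section \<open>The sphere as a simplex modulo its boundary\<close>

text \<open>
  Centre the simplex at its barycentre and drop coordinate 0; this gives a vector \<open>w\<close> of
  \<open>d\<close> coordinates. The number \<open>t\<close> is 1 at the barycentre and falls linearly along rays to 0 on the
  boundary, so \<open>w / t\<close> parametrises the open simplex by the whole \<open>d\<close>-dimensional space. The chart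
  is the inverse stereographic projection of \<open>w / t\<close>, with numerator and denominator multiplied by
  \<open>t\<^sup>2\<close>: in this form it also makes sense for \<open>t = 0\<close>, where it gives the pole
  \<open>sphere_basepoint\<close>.
\<close>

definition simplex_chart :: "nat \<Rightarrow> (nat \<Rightarrow> real) \<Rightarrow> nat \<Rightarrow> real" where
  "simplex_chart d y =
     (let c = 1 / (real d + 1); t = (real d + 1) * Min (y ` {..d}); Q = (\<Sum>j=1..d. (y j - c)\<^sup>2)
      in (\<lambda>j. if j = 0 then (Q - t\<^sup>2) / (Q + t\<^sup>2)
              else if j \<le> d then 2 * t * (y j - c) / (Q + t\<^sup>2) else 0))"

definition coord_simplex :: "nat \<Rightarrow> (nat \<Rightarrow> real) set" where
  "coord_simplex d = {y. (\<forall>j\<le>d. 0 \<le> y j) \<and> (\<Sum>j\<le>d. y j) = 1}"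

lemma sum_atMost_split0: "(\<Sum>j\<le>d. f j) = f 0 + (\<Sum>j=1..d. f j :: real)" for d :: nat
  by (simp add: sum.atLeast_Suc_atMost atMost_atLeast0)

text \<open>
  If all centred coordinates but one vanish, then so does the remaining one because the coordinates
  sum to 1. Hence the only point with \<open>w = 0\<close> is the barycentre, where \<open>t = 1\<close>.
\<close>

lemma simplex_chart_denominator:
  assumes y: "y \<in> coord_simplex d"
  shows "0 < (\<Sum>j=1..d. (y j - 1 / (real d + 1))\<^sup>2) + ((real d + 1) * Min (y ` {..d}))\<^sup>2"
    (is "0 < ?Q + ?t\<^sup>2")
proof (rule ccontr)
  let ?c = "1 / (real d + 1)"
  assume neg: "\<not> 0 < ?Q + ?t\<^sup>2"
  have Q0: "0 \<le> ?Q" by (intro sum_nonneg) auto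
  have "?Q = 0" "?t\<^sup>2 = 0" using neg Q0 zero_le_power2[of ?t] by linarith+
  then have w: "y j = ?c" if "j \<in> {1..d}" for j
    using that by (subst (asm) sum_nonneg_eq_0_iff) auto
  have "(\<Sum>j\<le>d. y j) = y 0 + (\<Sum>j=1..d. ?c)"
    unfolding sum_atMost_split0 using w by simp
  then have "y 0 = ?c" using y by (simp add: coord_simplex_def field_simps)
  then have "y j = ?c" if "j \<le> d" for j using w[of j] that by (cases "j = 0") auto
  then have "y ` {..d} = {?c}" by force
  then have "?t = 1" by simp
  then show False using \<open>?t\<^sup>2 = 0\<close> by simp
qed

lemma simplex_chart_in_nsphere:
  assumes y: "y \<in> coord_simplex d"
  shows "simplex_chart d y \<in> topspace (nsphere d)"
proof -
  define c where "c = 1 / (real d + 1)"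
  define t where "t = (real d + 1) * Min (y ` {..d})"
  define Q where "Q = (\<Sum>j=1..d. (y j - c)\<^sup>2)"
  have D: "0 < Q + t\<^sup>2" using simplex_chart_denominator[OF y] by (simp add: c_def t_def Q_def)
  have chart: "simplex_chart d y = (\<lambda>j. if j = 0 then (Q - t\<^sup>2) / (Q + t\<^sup>2)
              else if j \<le> d then 2 * t * (y j - c) / (Q + t\<^sup>2) else 0)"
    unfolding simplex_chart_def Let_def c_def t_def Q_def by (rule refl)
  have "(\<Sum>j\<le>d. (simplex_chart d y j)\<^sup>2)
      = ((Q - t\<^sup>2) / (Q + t\<^sup>2))\<^sup>2 + (\<Sum>j=1..d. (2 * t / (Q + t\<^sup>2))\<^sup>2 * (y j - c)\<^sup>2)"
    unfolding sum_atMost_split0 by (simp add: chart power_mult_distrib power_divide)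
  also have "\<dots> = ((Q - t\<^sup>2) / (Q + t\<^sup>2))\<^sup>2 + (2 * t / (Q + t\<^sup>2))\<^sup>2 * Q"
    by (simp only: Q_def sum_distrib_left)
  also have "\<dots> = ((Q - t\<^sup>2)\<^sup>2 + 4 * t\<^sup>2 * Q) / (Q + t\<^sup>2)\<^sup>2"
    by (simp add: power_divide add_divide_distrib power_mult_distrib)
  also have "(Q - t\<^sup>2)\<^sup>2 + 4 * t\<^sup>2 * Q = (Q + t\<^sup>2)\<^sup>2" by algebra
  also have "(Q + t\<^sup>2)\<^sup>2 / (Q + t\<^sup>2)\<^sup>2 = 1" using D by simp
  finally show ?thesis by (simp add: nsphere chart)
qed

lemma simplex_chart_eq_basepoint_iff:
  assumes y: "y \<in> coord_simplex d"
  shows "simplex_chart d y = sphere_basepoint \<longleftrightarrow> Min (y ` {..d}) = 0"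
proof -
  define c where "c = 1 / (real d + 1)"
  define t where "t = (real d + 1) * Min (y ` {..d})"
  define Q where "Q = (\<Sum>j=1..d. (y j - c)\<^sup>2)"
  have D: "0 < Q + t\<^sup>2" using simplex_chart_denominator[OF y] by (simp add: c_def t_def Q_def)
  have chart: "simplex_chart d y = (\<lambda>j. if j = 0 then (Q - t\<^sup>2) / (Q + t\<^sup>2)
              else if j \<le> d then 2 * t * (y j - c) / (Q + t\<^sup>2) else 0)"
    unfolding simplex_chart_def Let_def c_def t_def Q_def by (rule refl)
  have "simplex_chart d y = sphere_basepoint \<longleftrightarrow> t = 0"
  proof
    assume "simplex_chart d y = sphere_basepoint"
    then have "simplex_chart d y 0 = sphere_basepoint 0" by simp
    then have "Q - t\<^sup>2 = Q + t\<^sup>2" using D by (simp add: chart sphere_basepoint_def)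
    then show "t = 0" by simp
  next
    assume "t = 0"
    then show "simplex_chart d y = sphere_basepoint"
      using D by (simp add: chart sphere_basepoint_def fun_eq_iff)
  qed
  then show ?thesis by (simp add: t_def)
qed

text \<open>
  Stereographic projection recovers \<open>w / t\<close> from the chart, and the dropped coordinate of \<open>w\<close> is minus
  the sum of the others.
\<close>

lemma simplex_chart_eq_imp_same_ray:
  assumes y: "y \<in> coord_simplex d" and z: "z \<in> coord_simplex d"
    and eq: "simplex_chart d y = simplex_chart d z"
    and pos: "0 < Min (y ` {..d})" "0 < Min (z ` {..d})"
  shows "\<And>j. j \<le> d \<Longrightarrow> (y j - 1 / (real d + 1)) / Min (y ` {..d}) = (z j - 1 / (real d + 1)) / Min (z ` {..d})"
proof -
  define c where "c = 1 / (real d + 1)"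
  define m where "m y = Min (y ` {..d})" for y :: "nat \<Rightarrow> real"
  have coord: "(y j - c) / m y = (real d + 1) * (simplex_chart d y j / (1 - simplex_chart d y 0))"
    if y: "y \<in> coord_simplex d" "0 < m y" and j: "1 \<le> j" "j \<le> d" for y j
  proof -
    define t where "t = (real d + 1) * m y"
    define Q where "Q = (\<Sum>j=1..d. (y j - c)\<^sup>2)"
    have D: "0 < Q + t\<^sup>2"
      using simplex_chart_denominator[OF y(1)] by (simp add: c_def t_def Q_def m_def)
    have t: "0 < t" using y by (simp add: t_def)
    have chart: "simplex_chart d y = (\<lambda>j. if j = 0 then (Q - t\<^sup>2) / (Q + t\<^sup>2)
              else if j \<le> d then 2 * t * (y j - c) / (Q + t\<^sup>2) else 0)"
      unfolding simplex_chart_def Let_def c_def t_def Q_def m_def by (rule refl)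
    have "1 - simplex_chart d y 0 = 2 * t\<^sup>2 / (Q + t\<^sup>2)"
      using D by (simp add: chart field_simps)
    moreover have "simplex_chart d y j = 2 * t * (y j - c) / (Q + t\<^sup>2)" using j by (simp add: chart)
    ultimately have "simplex_chart d y j / (1 - simplex_chart d y 0) = (y j - c) / t"
      using D t by (simp add: power2_eq_square)
    then show ?thesis using y(2) by (simp add: t_def)
  qed
  have coord0: "(y 0 - c) / m y = - (\<Sum>j=1..d. (y j - c) / m y)" if "y \<in> coord_simplex d" for y
  proof -
    have "(\<Sum>j\<le>d. y j - c) = 0"
      using that by (simp add: coord_simplex_def sum_subtractf c_def)
    then have "y 0 - c = - (\<Sum>j=1..d. y j - c)" unfolding sum_atMost_split0 by simp
    then show ?thesis by (simp only: sum_divide_distrib[symmetric] minus_divide_left)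
  qed
  have pos_coord: "(y j - c) / m y = (z j - c) / m z" if "1 \<le> j" "j \<le> d" for j
    using coord[OF y _ that] coord[OF z _ that] pos eq by (simp add: m_def)
  show "(y j - 1 / (real d + 1)) / Min (y ` {..d}) = (z j - 1 / (real d + 1)) / Min (z ` {..d})" 
    if "j \<le> d" for j
  proof (cases "j = 0")
    case True
    have "(y 0 - c) / m y = (z 0 - c) / m z"
      unfolding coord0[OF y] coord0[OF z] using pos_coord by (intro arg_cong[of _ _ uminus] sum.cong) auto
    then show ?thesis using True by (simp add: c_def m_def)
  next
    case False
    then show ?thesis using pos_coord[of j] that by (simp add: c_def m_def)
  qed
qed

text \<open>
  By the preceding lemma the two points lie on the same ray from the barycentre. Comparing both
  points at a coordinate where one of them attains its minimum orders the minima, and by symmetry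
  the minima agree.
\<close>

lemma simplex_chart_inj:
  assumes y: "y \<in> coord_simplex d" and z: "z \<in> coord_simplex d"
    and eq: "simplex_chart d y = simplex_chart d z"
    and pos: "0 < Min (y ` {..d})" "0 < Min (z ` {..d})" and j: "j \<le> d"
  shows "y j = z j"
proof -
  let ?m = "\<lambda>y. Min (y ` {..d})" and ?c = "1 / (real d + 1)"
  have le: "?m z \<le> ?m y"
    if rel: "\<And>j. j \<le> d \<Longrightarrow> (y j - ?c) / ?m y = (z j - ?c) / ?m z" 
    and pos: "0 < ?m y" "0 < ?m z" for y z :: "nat \<Rightarrow> real"
  proof -
    have "?m y \<in> y ` {..d}" by (intro Min_in) auto
    then obtain j where "?m y = y j" "j \<in> {..d}" by (rule imageE)
    then have j: "j \<le> d" "y j = ?m y" by simp_all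
    have "?m z \<le> z j" using j by simp
    have "(?m z - ?c) / ?m z \<le> (z j - ?c) / ?m z"
      by (rule divide_right_mono[OF diff_right_mono[OF \<open>?m z \<le> z j\<close>] less_imp_le[OF pos(2)]])
    also have "\<dots> = (?m y - ?c) / ?m y" using rel[OF j(1)] j(2) by simp
    finally have "1 - ?c / ?m z \<le> 1 - ?c / ?m y" using pos by (simp add: diff_divide_distrib)
    then have "?c / ?m y \<le> ?c / ?m z" by simp
    moreover have "b \<le> a" if "0 < c" "0 < a" "0 < b" "c / a \<le> c / b" for a b c :: real
      using that by (simp add: field_simps)
    moreover have "0 < ?c" by simp
    ultimately show ?thesis using pos by blast
  qed
  note rel = simplex_chart_eq_imp_same_ray[OF y z eq pos]
  have "?m y = ?m z"
    by (rule order_antisym[OF le[OF rel[symmetric] pos(2) pos(1)] le[OF rel pos]])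
  moreover have "?m z \<noteq> 0" using pos(2) by linarith
  ultimately have "y j - ?c = z j - ?c" using rel[OF j] by (simp only: divide_cancel_right) blast
  then show ?thesis by linarith
qed

text \<open>
  Inverse of the chart. Stereographic projection sends \<open>s\<close> to the point of the \<open>d\<close>-dimensional space
  whose coordinates are \<open>V j\<close> for \<open>j \<ge> 1\<close>, and \<open>V 0\<close> is chosen to make the sum vanish. The
  point of the simplex on the ray through \<open>V\<close> is the barycentre plus \<open>t * V\<close>; the requirement
  that \<open>t\<close> be its radial coordinate is a linear equation whose solution is
  \<open>1 / (1 - (d + 1) * \<mu>)\<close> with \<open>\<mu>\<close> the least coordinate of \<open>V\<close>.
\<close>

lemma simplex_chart_surj:
  assumes s: "s \<in> topspace (nsphere d)" "s \<noteq> sphere_basepoint"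
  obtains y where "y \<in> coord_simplex d" "0 < Min (y ` {..d})" "simplex_chart d y = s"
proof -
  have s1: "(\<Sum>j\<le>d. (s j)\<^sup>2) = 1" and s0: "\<And>j. j > d \<Longrightarrow> s j = 0" using s by (auto simp: nsphere)
  define R where "R = (\<Sum>j=1..d. (s j)\<^sup>2)"
  have R: "(s 0)\<^sup>2 + R = 1" "0 \<le> R" using s1 unfolding sum_atMost_split0 R_def by (auto intro: sum_nonneg)
  have "s 0 \<noteq> 1"
  proof
    assume 1: "s 0 = 1"
    then have "R = 0" using R by simp
    then have "s j = 0" if "j \<in> {1..d}" for j
      using that unfolding R_def by (subst (asm) sum_nonneg_eq_0_iff) auto
    then have "s = sphere_basepoint" using 1 s0
      by (auto simp: sphere_basepoint_def fun_eq_iff) (metis One_nat_def Suc_leI atLeastAtMost_iff not_le_imp_less neq0_conv)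
    then show False using s by simp
  qed
  moreover have "(s 0)\<^sup>2 \<le> 1" using R by linarith
  ultimately have u: "0 < 1 - s 0" using abs_square_le_1[of "s 0"] by auto
  define V where "V j = (if j = 0 then - (\<Sum>j=1..d. s j / (1 - s 0)) else s j / (1 - s 0))" for j
  have V0: "(\<Sum>j\<le>d. V j) = 0" unfolding sum_atMost_split0 by (simp add: V_def)
  define \<mu> where "\<mu> = Min (V ` {..d})"
  have \<mu>_le: "\<mu> \<le> V j" if "j \<le> d" for j unfolding \<mu>_def using that by simp
  have "\<mu> \<le> 0"
  proof (rule ccontr)
    assume "\<not> \<mu> \<le> 0"
    then have "0 < V j" if "j \<le> d" for j using \<mu>_le[OF that] by linarith
    then have "0 < (\<Sum>j\<le>d. V j)" by (intro sum_pos) auto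
    then show False using V0 by simp
  qed
  define n where "n = real d + 1"
  have n: "0 < n" by (simp add: n_def)
  have "n * \<mu> \<le> 0" using \<open>\<mu> \<le> 0\<close> n by (intro mult_nonneg_nonpos) auto
  then have den: "0 < 1 - n * \<mu>" by linarith
  define t where "t = 1 / (1 - n * \<mu>)"
  have t: "0 < t" "t * (1 - n * \<mu>) = 1" using den by (auto simp: t_def)
  define y where "y j = 1 / n + t * V j" for j
  have "Min (y ` {..d}) = 1 / n + t * \<mu>"
  proof (rule Min_eqI)
    have "\<mu> \<in> V ` {..d}" unfolding \<mu>_def by (intro Min_in) auto
    then show "1 / n + t * \<mu> \<in> y ` {..d}" by (auto simp: y_def)
    show "1 / n + t * \<mu> \<le> a" if "a \<in> y ` {..d}" for a
      using that \<mu>_le t by (auto simp: y_def)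
  qed simp
  moreover have "n * (1 / n + t * \<mu>) = t" using t(2) n by (simp add: algebra_simps)
  ultimately have min_y: "n * Min (y ` {..d}) = t" by simp
  then have min_pos: "0 < Min (y ` {..d})" using t n by (metis zero_less_mult_pos)
  have "0 \<le> y j" if "j \<le> d" for j
  proof -
    have "Min (y ` {..d}) \<le> y j" using that by simp
    then show ?thesis using min_pos by linarith
  qed
  moreover have "(\<Sum>j\<le>d. y j) = 1"
    unfolding y_def sum.distrib using V0 by (simp add: n_def sum_distrib_left[symmetric])
  ultimately have y: "y \<in> coord_simplex d" by (simp add: coord_simplex_def)
  have w: "y j - 1 / n = t * s j / (1 - s 0)" if "j \<ge> 1" for j using that by (simp add: y_def V_def)
  have "(\<Sum>j=1..d. (y j - 1 / n)\<^sup>2) = (\<Sum>j=1..d. (t / (1 - s 0))\<^sup>2 * (s j)\<^sup>2)"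
    by (intro sum.cong) (auto simp: w power_divide power_mult_distrib)
  also have "\<dots> = t\<^sup>2 * (R / (1 - s 0)\<^sup>2)"
    unfolding R_def sum_distrib_left[symmetric] by (simp add: power_divide)
  also have "R / (1 - s 0)\<^sup>2 = (1 + s 0) / (1 - s 0)"
  proof -
    have "R = (1 + s 0) * (1 - s 0)" using R by (simp add: algebra_simps power2_eq_square)
    then show ?thesis using u by (simp add: power2_eq_square)
  qed
  finally have Q: "(\<Sum>j=1..d. (y j - 1 / n)\<^sup>2) = t\<^sup>2 * ((1 + s 0) / (1 - s 0))" .
  have D: "t\<^sup>2 * ((1 + s 0) / (1 - s 0)) + t\<^sup>2 = 2 * t\<^sup>2 / (1 - s 0)"
    using u by (simp add: field_simps)
  have D': "t\<^sup>2 * ((1 + s 0) / (1 - s 0)) - t\<^sup>2 = 2 * t\<^sup>2 * s 0 / (1 - s 0)"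
    using u by (simp add: field_simps)
  have chart: "simplex_chart d y = (\<lambda>j. if j = 0 then (2 * t\<^sup>2 * s 0 / (1 - s 0)) / (2 * t\<^sup>2 / (1 - s 0))
              else if j \<le> d then 2 * t * (y j - 1 / n) / (2 * t\<^sup>2 / (1 - s 0)) else 0)"
    unfolding simplex_chart_def Let_def n_def[symmetric] min_y Q D D' by simp
  have "simplex_chart d y j = s j" for j
    using t u s0[of j] w[of j] by (auto simp: chart power2_eq_square)
  then show ?thesis using that y min_pos by blast
qed

lemma simplex_chart_cong:
  assumes "\<And>j. j \<le> d \<Longrightarrow> y j = z j"
  shows "simplex_chart d y = simplex_chart d z"
proof -
  have "y ` {..d} = z ` {..d}" using assms by (intro image_cong) auto
  moreover have "(\<Sum>j=1..d. (y j - c)\<^sup>2) = (\<Sum>j=1..d. (z j - c)\<^sup>2)" for c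
    using assms by (intro sum.cong) auto
  ultimately show ?thesis using assms unfolding simplex_chart_def Let_def by (simp add: fun_eq_iff)
qed

lemma continuous_on_simplex_chart: "continuous_on (coord_simplex d) (simplex_chart d)"
proof -
  let ?c = "1 / (real d + 1)"
  let ?t = "\<lambda>y. (real d + 1) * Min (y ` {..d})" and ?Q = "\<lambda>y. \<Sum>j=1..d. (y j - ?c)\<^sup>2"
  have t: "continuous_on (coord_simplex d) ?t"
    by (intro continuous_intros continuous_on_Min_image continuous_on_coord) auto
  have Q: "continuous_on (coord_simplex d) ?Q" by (intro continuous_intros)
  have ne: "\<forall>y\<in>coord_simplex d. ?Q y + (?t y)\<^sup>2 \<noteq> 0"
    using simplex_chart_denominator by (metis less_irrefl)
  show ?thesis
    unfolding simplex_chart_def Let_def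
    by (intro continuous_on_coordinatewise_then_product continuous_on_if_const
        continuous_on_divide continuous_on_diff continuous_on_add continuous_on_mult
        continuous_on_power continuous_on_const continuous_on_coord t Q ne)
qed

definition closed_simplex :: "'v::finite set \<Rightarrow> ('v \<Rightarrow> real) set" where
  "closed_simplex h = {x. (\<forall>v. 0 \<le> x v) \<and> (\<Sum>v\<in>UNIV. x v) = 1 \<and> {v. x v \<noteq> 0} \<subseteq> h}"

lemma closed_closed_simplex:
  fixes h :: "'v::finite set" shows "closed (closed_simplex h)"
proof -
  have "closed {x :: 'v \<Rightarrow> real. (\<forall>v. 0 \<le> x v) \<and> (\<Sum>v\<in>UNIV. x v) = 1 \<and> (\<forall>v. v \<notin> h \<longrightarrow> x v = 0)}"
    by (intro closed_Collect_conj closed_Collect_all closed_Collect_imp closed_Collect_le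
        closed_Collect_eq continuous_intros) auto
  moreover have "closed_simplex h
      = {x. (\<forall>v. 0 \<le> x v) \<and> (\<Sum>v\<in>UNIV. x v) = 1 \<and> (\<forall>v. v \<notin> h \<longrightarrow> x v = 0)}"
    unfolding closed_simplex_def by blast
  ultimately show ?thesis by simp
qed

lemma compact_closed_simplex:
  fixes h :: "'v::finite set" shows "compact (closed_simplex h)"
proof -
  have "compact (PiE UNIV (\<lambda>_. {0..1}) :: ('v \<Rightarrow> real) set)"
    using compactin_PiE[of "\<lambda>_. euclideanreal" UNIV "\<lambda>_::'v. {0..1}"]
    by (simp add: euclidean_product_topology compactin_euclidean_iff)
  moreover have "closed_simplex h \<subseteq> PiE UNIV (\<lambda>_. {0..1})"
  proof
    fix x assume x: "x \<in> closed_simplex h"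
    have "x v \<le> 1" for v
      using x member_le_sum[of v UNIV x] by (simp add: closed_simplex_def)
    then show "x \<in> PiE UNIV (\<lambda>_. {0..1})" using x by (auto simp: closed_simplex_def)
  qed
  ultimately show ?thesis
    using closed_closed_simplex by (metis compact_Int_closed inf.absorb_iff2)
qed

lemma closed_polyhedron:
  fixes K :: "'v::finite set set" assumes "down_closed K" shows "closed (polyhedron K)"
proof -
  have "polyhedron K = (\<Union>h\<in>K. closed_simplex h)"
    using down_closedD[OF assms] by (auto simp: polyhedron_def closed_simplex_def)
  moreover have "closed (\<Union>h\<in>K. closed_simplex h)"
    by (intro closed_UN ballI closed_closed_simplex) simp
  ultimately show ?thesis by simp
qed

lemma nsphere_eq_top_of_set:
  "nsphere d = top_of_set {x. (\<Sum>i\<le>d. (x i)\<^sup>2) = 1 \<and> (\<forall>i>d. x i = 0)}"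
  by (simp add: nsphere euclidean_product_topology)

lemma Hausdorff_nsphere: "Hausdorff_space (nsphere d)"
  unfolding nsphere by (intro Hausdorff_space_subtopology) (simp add: Hausdorff_space_product_topology)

lemma sphere_basepoint_in_nsphere: "sphere_basepoint \<in> topspace (nsphere d)"
  unfolding sphere_basepoint_def by (rule in_topspace_nsphere)

text \<open>
  The map identifies the simplex modulo its boundary with the sphere. The base point is excluded in
  the last clause because a simplex of dimension 0 has empty boundary, so that its image in the
  0-sphere misses the base point.
\<close>

definition sphere_quotient_map ::
    "nat \<Rightarrow> 'v::finite set \<Rightarrow> (('v \<Rightarrow> real) \<Rightarrow> nat \<Rightarrow> real) \<Rightarrow> bool" where
  "sphere_quotient_map d h \<phi> \<longleftrightarrow> continuous_map (top_of_set (closed_simplex h)) (nsphere d) \<phi> \<and>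
     (\<forall>x\<in>closed_simplex h. \<phi> x = sphere_basepoint \<longleftrightarrow> {v. x v \<noteq> 0} \<noteq> h) \<and>
     (\<forall>x\<in>closed_simplex h. \<forall>y\<in>closed_simplex h.
        {v. x v \<noteq> 0} = h \<longrightarrow> {v. y v \<noteq> 0} = h \<longrightarrow> \<phi> x = \<phi> y \<longrightarrow> x = y) \<and>
     (\<forall>s\<in>topspace (nsphere d). s \<noteq> sphere_basepoint \<longrightarrow> (\<exists>x\<in>closed_simplex h. \<phi> x = s))"

lemma sphere_quotient_map_exists:
  fixes h :: "'v::finite set"
  assumes "card h = d + 1"
  shows "\<exists>\<phi>. sphere_quotient_map d h \<phi>"
proof -
  have "{0..<card h} = {..d}" using assms by auto
  then obtain e where e: "bij_betw e {..d} h" using ex_bij_betw_nat_finite[of h] by auto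
  have h: "h = e ` {..d}" using e by (simp add: bij_betw_def)
  have hne: "h \<noteq> {}" using assms by auto
  have coord: "x \<circ> e \<in> coord_simplex d" and Min: "Min ((x \<circ> e) ` {..d}) = Min (x ` h)"
    and Min0: "Min (x ` h) = 0 \<longleftrightarrow> {v. x v \<noteq> 0} \<noteq> h" "0 \<le> Min (x ` h)"
    if x: "x \<in> closed_simplex h" for x
  proof -
    have "(\<Sum>j\<le>d. x (e j)) = (\<Sum>v\<in>h. x v)" by (rule sum.reindex_bij_betw[OF e])
    also have "\<dots> = (\<Sum>v\<in>UNIV. x v)"
      using x by (intro sum.mono_neutral_left) (auto simp: closed_simplex_def)
    also have "\<dots> = 1" using x by (simp add: closed_simplex_def)
    finally show "x \<circ> e \<in> coord_simplex d" using x by (simp add: coord_simplex_def closed_simplex_def)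
    show "Min ((x \<circ> e) ` {..d}) = Min (x ` h)" unfolding h by (simp only: image_comp)
    have x0: "\<forall>v. 0 \<le> x v" and sub: "{v. x v \<noteq> 0} \<subseteq> h" using x by (auto simp: closed_simplex_def)
    show "Min (x ` h) = 0 \<longleftrightarrow> {v. x v \<noteq> 0} \<noteq> h"
      unfolding Min_coords_eq_0_iff[OF hne x0] using sub by blast
    show "0 \<le> Min (x ` h)" by (rule Min_coords_nonneg[OF hne x0])
  qed
  show ?thesis
    unfolding sphere_quotient_map_def
  proof (intro exI[of _ "\<lambda>x. simplex_chart d (x \<circ> e)"] conjI ballI impI)
    have "continuous_on (closed_simplex h) (\<lambda>x. x \<circ> e)"
      unfolding comp_def by (intro continuous_on_coordinatewise_then_product continuous_on_coord)
    then have "continuous_on (closed_simplex h) (\<lambda>x. simplex_chart d (x \<circ> e))"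
      by (rule continuous_on_compose2[OF continuous_on_simplex_chart]) (use coord in auto)
    then show "continuous_map (top_of_set (closed_simplex h)) (nsphere d) (\<lambda>x. simplex_chart d (x \<circ> e))"
      using simplex_chart_in_nsphere[OF coord] unfolding nsphere_eq_top_of_set by auto
    show "simplex_chart d (x \<circ> e) = sphere_basepoint \<longleftrightarrow> {v. x v \<noteq> 0} \<noteq> h"
      if "x \<in> closed_simplex h" for x
      using simplex_chart_eq_basepoint_iff[OF coord[OF that]] Min[OF that] Min0[OF that] by (simp only:)
    show "x = y" if x: "x \<in> closed_simplex h" "{v. x v \<noteq> 0} = h"
        and y: "y \<in> closed_simplex h" "{v. y v \<noteq> 0} = h"
        and eq: "simplex_chart d (x \<circ> e) = simplex_chart d (y \<circ> e)" for x y
    proof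
      fix v
      have pos: "0 < Min ((x \<circ> e) ` {..d})" "0 < Min ((y \<circ> e) ` {..d})"
      proof -
        have "Min (x ` h) \<noteq> 0" "Min (y ` h) \<noteq> 0"
          using Min0(1)[OF x(1)] Min0(1)[OF y(1)] x(2) y(2) by blast+
        then show "0 < Min ((x \<circ> e) ` {..d})" "0 < Min ((y \<circ> e) ` {..d})"
          unfolding Min[OF x(1)] Min[OF y(1)] using Min0(2)[OF x(1)] Min0(2)[OF y(1)] by linarith+
      qed
      show "x v = y v"
      proof (cases "v \<in> h")
        case True
        then obtain j where j: "j \<le> d" "v = e j" unfolding h by auto
        show ?thesis
          using simplex_chart_inj[OF coord[OF x(1)] coord[OF y(1)] eq pos j(1)] j(2) by simp
      next
        case False
        then have "v \<notin> {v. x v \<noteq> 0}" "v \<notin> {v. y v \<noteq> 0}" by (simp_all only: x(2) y(2) not_False_eq_True)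
        then show ?thesis by simp
      qed
    qed
    show "\<exists>x\<in>closed_simplex h. simplex_chart d (x \<circ> e) = s"
      if s: "s \<in> topspace (nsphere d)" "s \<noteq> sphere_basepoint" for s
    proof -
      obtain y where y: "y \<in> coord_simplex d" "simplex_chart d y = s"
        using simplex_chart_surj[OF s] by metis
      define x where "x v = (if v \<in> h then y (inv_into {..d} e v) else 0)" for v
      have xe: "x (e j) = y j" if "j \<le> d" for j
        using that e by (auto simp: x_def h bij_betw_def)
      have "(\<Sum>v\<in>UNIV. x v) = (\<Sum>v\<in>h. x v)"
        by (intro sum.mono_neutral_right) (auto simp: x_def)
      also have "\<dots> = (\<Sum>j\<le>d. x (e j))" by (rule sum.reindex_bij_betw[OF e, symmetric])
      also have "\<dots> = 1" using y(1) xe by (simp add: coord_simplex_def)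
      finally have sum1: "(\<Sum>v\<in>UNIV. x v) = 1" .
      have "0 \<le> x v" for v
      proof (cases "v \<in> h")
        case True
        then show ?thesis using xe y(1) unfolding h by (auto simp: coord_simplex_def)
      qed (simp add: x_def)
      moreover have "{v. x v \<noteq> 0} \<subseteq> h" by (auto simp: x_def)
      ultimately have "x \<in> closed_simplex h" using sum1 by (simp add: closed_simplex_def)
      moreover have "simplex_chart d (x \<circ> e) = s"
        unfolding y(2)[symmetric] using xe by (intro simplex_chart_cong) simp
      ultimately show ?thesis by blast
    qed
  qed
qed

section \<open>Complexes that are contractible up to facets\<close>

lemma down_closed_diff_facets:
  fixes K H :: "'v::finite set set"
  assumes K: "down_closed K" and H: "\<And>h. h \<in> H \<Longrightarrow> card h = r"
    and dim: "\<And>\<tau>. \<tau> \<in> K \<Longrightarrow> card \<tau> \<le> r"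
  shows "down_closed (K - H)"
  unfolding down_closed_def
proof (intro ballI allI impI)
  fix \<tau> \<rho> assume \<tau>: "\<tau> \<in> K - H" "\<rho> \<subseteq> \<tau>"
  have "\<rho> \<notin> H"
  proof
    assume "\<rho> \<in> H"
    then have "card \<tau> \<le> card \<rho>" using dim H \<tau> by simp
    then have "\<rho> = \<tau>" using \<tau> by (intro card_seteq) auto
    then show False using \<open>\<rho> \<in> H\<close> \<tau> by simp
  qed
  then show "\<rho> \<in> K - H" using down_closedD[OF K] \<tau> by blast
qed

text \<open>
  Sending \<open>K - H\<close> to the base point and each simplex of \<open>H\<close> to its own sphere is a quotient map
  onto the wedge: openness of a set in the wedge is tested on the individual spheres, and there the
  complement is the image of a compact set, up to the base point. Its only nontrivial fibre is
  \<open>K - H\<close>, so the extended contraction of \<open>K - H\<close> makes it a homotopy equivalence.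
\<close>

theorem complex_minus_contractible_wedge:
  fixes K H :: "'v::finite set set"
  assumes K: "down_closed K" and H: "H \<subseteq> K" "\<And>h. h \<in> H \<Longrightarrow> card h = d + 1"
    and dim: "\<And>\<tau>. \<tau> \<in> K \<Longrightarrow> card \<tau> \<le> d + 1"
    and contr: "contractible (polyhedron (K - H))" and ne: "polyhedron (K - H) \<noteq> {}"
  shows "top_of_set (polyhedron K) homotopy_equivalent_space wedge_of_spheres (card H) d"
proof -
  let ?P = "polyhedron K" and ?P' = "polyhedron (K - H)" and ?S = "nsphere d"
  let ?W = "wedge_of_spheres (card H) d" and ?b = "\<lambda>_::nat. sphere_basepoint"
  have "\<forall>h\<in>H. \<exists>\<phi>. sphere_quotient_map d h \<phi>"
    using sphere_quotient_map_exists H(2) by blast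
  then obtain \<phi> where "\<forall>h\<in>H. sphere_quotient_map d h (\<phi> h)" by (rule bchoice[THEN exE])
  then have \<phi>: "sphere_quotient_map d h (\<phi> h)" if "h \<in> H" for h using that by simp
  note \<phi> = \<phi>[unfolded sphere_quotient_map_def]
  have cont_\<phi>: "continuous_map (top_of_set (closed_simplex h)) ?S (\<phi> h)" if "h \<in> H" for h
    by (rule \<phi>[OF that, THEN conjunct1])
  have \<phi>_base: "\<phi> h x = sphere_basepoint \<longleftrightarrow> {v. x v \<noteq> 0} \<noteq> h"
    if "h \<in> H" "x \<in> closed_simplex h" for h x
    by (rule \<phi>[OF that(1), THEN conjunct2, THEN conjunct1, THEN bspec, OF that(2)])
  have \<phi>_inj: "x = y" if "h \<in> H" "x \<in> closed_simplex h" "y \<in> closed_simplex h"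
      "{v. x v \<noteq> 0} = h" "{v. y v \<noteq> 0} = h" "\<phi> h x = \<phi> h y" for h x y
    by (rule \<phi>[OF that(1), THEN conjunct2, THEN conjunct2, THEN conjunct1, rule_format, OF that(2-6)])
  have \<phi>_surj: "\<exists>x\<in>closed_simplex h. \<phi> h x = s"
    if "h \<in> H" "s \<in> topspace ?S" "s \<noteq> sphere_basepoint" for h s
    by (rule \<phi>[OF that(1), THEN conjunct2, THEN conjunct2, THEN conjunct2, rule_format, OF that(2,3)])
  obtain idx where idx: "bij_betw idx H {..<card H}"
    using ex_bij_betw_finite_nat[of H] by (auto simp: atLeast0LessThan)
  have idx_lt: "idx h < card H" if "h \<in> H" for h using bij_betwE[OF idx] that by auto
  define q where "q x = (if {v. x v \<noteq> 0} \<in> H then Some (idx {v. x v \<noteq> 0}, \<phi> {v. x v \<noteq> 0} x) else None)"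
    for x :: "'v \<Rightarrow> real"
  have simplex_P: "closed_simplex h \<subseteq> ?P" if "h \<in> H" for h
    using down_closedD[OF K, of h] H(1) that by (auto simp: closed_simplex_def polyhedron_def)
  have P_cases: "x \<in> ?P' \<and> {v. x v \<noteq> 0} \<notin> H \<or> {v. x v \<noteq> 0} \<in> H \<and> x \<in> closed_simplex {v. x v \<noteq> 0}"
    if "x \<in> ?P" for x
    using that by (auto simp: closed_simplex_def polyhedron_def)
  have P'_iff: "x \<in> ?P' \<longleftrightarrow> x \<in> ?P \<and> {v. x v \<noteq> 0} \<notin> H" for x
    by (auto simp: polyhedron_def)
  have q_simplex: "q x = wedge_proj ?b (idx h, \<phi> h x)" if h: "h \<in> H" and x: "x \<in> closed_simplex h" for h x
  proof (cases "{v. x v \<noteq> 0} = h")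
    case True
    then show ?thesis using h \<phi>_base[OF h x] by (simp add: q_def wedge_proj_def)
  next
    case False
    then have "{v. x v \<noteq> 0} \<subset> h" using x by (auto simp: closed_simplex_def)
    then have "card {v. x v \<noteq> 0} < card h" by (intro psubset_card_mono) auto
    then have "{v. x v \<noteq> 0} \<notin> H" using H(2) h by fastforce
    then show ?thesis using False \<phi>_base[OF h x] by (simp add: q_def wedge_proj_def)
  qed
  have q_P': "q x = None" if "x \<in> ?P'" for x using that P'_iff by (simp add: q_def)
  have topW: "topspace ?W = insert None (wedge_proj ?b ` ({..<card H} \<times> topspace ?S))"
    by (simp add: wedge_of_spheres_def topspace_wedge comp_def)
  have cont_q: "continuous_map (top_of_set ?P) ?W q"
  proof (rule pasting_lemma_closed[where I = "insert None (Some ` H)"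
        and T = "case_option ?P' closed_simplex" and f = "\<lambda>_. q"])
    have "down_closed (K - H)" using K H(2) dim by (rule down_closed_diff_facets)
    then have "closedin (top_of_set ?P) ?P'"
      using P'_iff by (intro closed_subset closed_polyhedron) auto
    then show "closedin (top_of_set ?P) (case_option ?P' closed_simplex i)"
      if "i \<in> insert None (Some ` H)" for i
      using that by (auto intro: closed_subset[OF simplex_P closed_closed_simplex])
    show "continuous_map (subtopology (top_of_set ?P) (case_option ?P' closed_simplex i)) ?W q"
      if "i \<in> insert None (Some ` H)" for i
    proof (cases i)
      case None
      have "continuous_map (top_of_set ?P') ?W (\<lambda>_. None)" by (simp add: topW)
      then have "continuous_map (top_of_set ?P') ?W q"
        by (rule continuous_map_eq) (simp add: q_P')
      moreover have "?P \<inter> ?P' = ?P'" using P'_iff by auto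
      ultimately show ?thesis using None by (simp add: subtopology_subtopology)
    next
      case (Some h)
      then have h: "h \<in> H" using that by auto
      have "continuous_map (top_of_set (closed_simplex h)) ?W (wedge_proj ?b \<circ> (Pair (idx h) \<circ> \<phi> h))"
      proof (intro continuous_map_compose[OF cont_\<phi>[OF h]] continuous_map_compose)
        show "continuous_map ?S (sum_topology (\<lambda>_. ?S) {..<card H}) (Pair (idx h))"
          using idx_lt[OF h] by (intro continuous_map_component_injection) simp
        show "continuous_map (sum_topology (\<lambda>_. ?S) {..<card H}) ?W (wedge_proj ?b)"
          unfolding wedge_of_spheres_def
        proof (intro quotient_imp_continuous_map quotient_map_wedge)
          show "{..<card H} \<noteq> {}" using idx_lt[OF h] by auto
        qed (rule sphere_basepoint_in_nsphere)
      qed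
      then have "continuous_map (top_of_set (closed_simplex h)) ?W q"
        by (rule continuous_map_eq) (simp add: q_simplex[OF h])
      moreover have "?P \<inter> closed_simplex h = closed_simplex h" using simplex_P[OF h] by auto
      ultimately show ?thesis using Some by (simp add: subtopology_subtopology)
    qed
    show "\<exists>j. j \<in> insert None (Some ` H) \<and> x \<in> case_option ?P' closed_simplex j \<and> q x = q x"
      if "x \<in> topspace (top_of_set ?P)" for x
      using P_cases[of x] that by (auto intro: exI[of _ None] exI[of _ "Some {v. x v \<noteq> 0}"])
  qed simp_all
  have open_q: "openin ?W U"
    if U: "U \<subseteq> topspace ?W" and op: "openin (top_of_set ?P) {x \<in> ?P. q x \<in> U}" for U
  proof -
    have "openin ?S {s \<in> topspace ?S. wedge_proj ?b (i, s) \<in> U}" if i: "i < card H" for i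
    proof -
      obtain h where h: "h \<in> H" "idx h = i" using idx i by (metis bij_betw_iff_bijections lessThan_iff)
      let ?A = "{x \<in> closed_simplex h. q x \<notin> U}"
      let ?C = "{s \<in> topspace ?S. wedge_proj ?b (i, s) \<notin> U}"
      have op_h: "openin (top_of_set (closed_simplex h)) {x \<in> closed_simplex h. q x \<in> U}"
      proof -
        obtain V where V: "open V" "{x \<in> ?P. q x \<in> U} = ?P \<inter> V" using op unfolding openin_open by blast
        have "{x \<in> closed_simplex h. q x \<in> U} = closed_simplex h \<inter> V"
          using V(2) simplex_P[OF h(1)] by blast
        then show ?thesis using openin_open_Int[OF V(1)] by simp
      qed
      have "closedin (top_of_set (closed_simplex h))
          (topspace (top_of_set (closed_simplex h)) - {x \<in> closed_simplex h. q x \<in> U})"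
        by (rule closedin_diff[OF closedin_topspace op_h])
      also have "topspace (top_of_set (closed_simplex h)) - {x \<in> closed_simplex h. q x \<in> U} = ?A"
        by auto
      finally have "closedin (top_of_set (closed_simplex h)) ?A" .
      moreover have "compact_space (top_of_set (closed_simplex h))"
        by (rule compact_space_subtopology) (simp add: compact_closed_simplex)
      then have "closed_map (top_of_set (closed_simplex h)) ?S (\<phi> h)"
        by (intro continuous_imp_closed_map_gen cont_\<phi> h Hausdorff_imp_kc_space Hausdorff_nsphere)
      ultimately have "closedin ?S (\<phi> h ` ?A)" by (simp add: closed_map_def)
      moreover have "closedin ?S {sphere_basepoint}"
        using Hausdorff_nsphere sphere_basepoint_in_nsphere by (simp add: closedin_Hausdorff_sing_eq)
      \<comment> \<open>The base point is added by hand to the closed set because for \<open>d = 0\<close> it is not a value of \<open>\<phi> h\<close>.\<close>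
      ultimately have "closedin ?S (\<phi> h ` ?A \<union> (if None \<in> U then {} else {sphere_basepoint}))"
        by (intro closedin_Un) simp_all
      moreover have "?C = \<phi> h ` ?A \<union> (if None \<in> U then {} else {sphere_basepoint})"
      proof (intro equalityI subsetI)
        fix s assume s: "s \<in> ?C"
        show "s \<in> \<phi> h ` ?A \<union> (if None \<in> U then {} else {sphere_basepoint})"
        proof (cases "s = sphere_basepoint")
          case True
          then show ?thesis using s by (auto simp: wedge_proj_def)
        next
          case False
          then obtain x where x: "x \<in> closed_simplex h" "\<phi> h x = s" using \<phi>_surj[OF h(1)] s by blast
          then show ?thesis using s q_simplex[OF h(1) x(1)] h(2) by auto
        qed
      next
        fix s assume s: "s \<in> \<phi> h ` ?A \<union> (if None \<in> U then {} else {sphere_basepoint})"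
        then consider x where "x \<in> ?A" "s = \<phi> h x" | "None \<notin> U" "s = sphere_basepoint"
          by (auto split: if_splits)
        then show "s \<in> ?C"
        proof cases
          case 1
          have "\<phi> h x \<in> topspace ?S"
            using continuous_map_image_subset_topspace[OF cont_\<phi>[OF h(1)]] 1(1) by auto
          then show ?thesis using 1 q_simplex[OF h(1), of x] h(2) by auto
        next
          case 2
          then show ?thesis using sphere_basepoint_in_nsphere by (simp add: wedge_proj_def)
        qed
      qed
      ultimately have "closedin ?S ?C" by simp
      then have "openin ?S (topspace ?S - ?C)" by blast
      moreover have "topspace ?S - ?C = {s \<in> topspace ?S. wedge_proj ?b (i, s) \<in> U}" by auto
      ultimately show ?thesis by simp
    qed
    then show ?thesis
      using U unfolding wedge_of_spheres_def openin_wedge topspace_wedge openin_sum_topology by auto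
  qed
  have "q ` ?P = topspace ?W"
  proof
    show "q ` ?P \<subseteq> topspace ?W" using continuous_map_image_subset_topspace[OF cont_q] by simp
    show "topspace ?W \<subseteq> q ` ?P"
    proof
      fix w assume w: "w \<in> topspace ?W"
      obtain x' where x': "x' \<in> ?P'" using ne by blast
      show "w \<in> q ` ?P"
      proof (cases w)
        case None
        then show ?thesis using q_P'[OF x'] x' P'_iff by force
      next
        case (Some z)
        then obtain i s where is_w: "i < card H" "s \<in> topspace ?S" "w = wedge_proj ?b (i, s)"
          using w by (auto simp: topW)
        then have "s \<noteq> sphere_basepoint" using Some by (auto simp: wedge_proj_def)
        obtain h where h: "h \<in> H" "idx h = i" using idx is_w(1) by (metis bij_betw_iff_bijections lessThan_iff)
        obtain x where x: "x \<in> closed_simplex h" "\<phi> h x = s"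
          using \<phi>_surj[OF h(1) is_w(2) \<open>s \<noteq> sphere_basepoint\<close>] by blast
        then have "q x = w" using q_simplex[OF h(1) x(1)] h(2) is_w(3) by simp
        then show ?thesis using x(1) simplex_P[OF h(1)] by blast
      qed
    qed
  qed
  then have quot: "quotient_map (top_of_set ?P) ?W q"
    unfolding quotient_map_def topspace_euclidean_subtopology
  proof (intro conjI allI impI iffI)
    fix U assume U: "U \<subseteq> topspace ?W"
    show "openin ?W U" if "openin (top_of_set ?P) {x \<in> ?P. q x \<in> U}" by (rule open_q[OF U that])
    show "openin (top_of_set ?P) {x \<in> ?P. q x \<in> U}" if "openin ?W U"
      using openin_continuous_map_preimage[OF cont_q that] by simp
  qed
  have fibre: "x = y \<or> x \<in> ?P' \<and> y \<in> ?P'" if "x \<in> ?P" "y \<in> ?P" "q x = q y" for x y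
  proof (cases "{v. x v \<noteq> 0} \<in> H")
    case False
    then have "{v. y v \<noteq> 0} \<notin> H" using that(3) by (auto simp: q_def split: if_splits)
    then show ?thesis using False that P'_iff by blast
  next
    case True
    then have y: "{v. y v \<noteq> 0} \<in> H" and eq: "idx {v. x v \<noteq> 0} = idx {v. y v \<noteq> 0}"
        "\<phi> {v. x v \<noteq> 0} x = \<phi> {v. y v \<noteq> 0} y"
      using that(3) by (auto simp: q_def split: if_splits)
    have "{v. x v \<noteq> 0} = {v. y v \<noteq> 0}"
      using eq(1) True y idx by (meson bij_betw_imp_inj_on inj_onD)
    then show ?thesis
      using \<phi>_inj[OF y, of x y] eq(2) P_cases[OF that(1)] P_cases[OF that(2)] True y by simp
  qed
  show ?thesis
  proof (rule contract_subcomplex_extends[OF K H dim contr])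
    fix F :: "real \<times> ('v \<Rightarrow> real) \<Rightarrow> 'v \<Rightarrow> real"
    assume F: "continuous_on ({0..1} \<times> ?P) F"
      "\<And>s x. s \<in> {0..1} \<Longrightarrow> x \<in> ?P \<Longrightarrow> F (s, x) \<in> ?P"
      "\<And>x. x \<in> ?P \<Longrightarrow> F (0, x) = x"
      "\<And>s x. s \<in> {0..1} \<Longrightarrow> x \<in> ?P' \<Longrightarrow> F (s, x) \<in> ?P'"
      "\<And>x y. x \<in> ?P' \<Longrightarrow> y \<in> ?P' \<Longrightarrow> F (1, x) = F (1, y)"
    show ?thesis
    proof (rule homotopy_equivalent_quotient[OF quot])
      show "continuous_map (prod_topology (top_of_set {0..1}) (top_of_set ?P)) (top_of_set ?P) F"
        unfolding prod_topology_subtopology_eu using F(1,2) by auto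
      show "F (0, x) = x" if "x \<in> topspace (top_of_set ?P)" for x using F(3) that by simp
      show "F (1, x) = F (1, y)"
        if "x \<in> topspace (top_of_set ?P)" "y \<in> topspace (top_of_set ?P)" "q x = q y" for x y
        using fibre[of x y] that F(5)[of x y] by auto
      show "q (F (s, x)) = q (F (s, y))"
        if "s \<in> {0..1}" "x \<in> topspace (top_of_set ?P)" "y \<in> topspace (top_of_set ?P)" "q x = q y" for s x y
      proof (cases "x = y")
        case False
        then have "x \<in> ?P'" "y \<in> ?P'" using fibre[of x y] that by auto
        then show ?thesis using q_P'[OF F(4)[OF that(1)]] by simp
      qed simp
    qed
  qed
qed

section \<open>Matroid complexes and their links\<close>

lemma collapsible_imp_vertex:
  assumes "collapsible K" "{} \<in> K"
  shows "\<exists>w. {w} \<in> K"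
  using assms
proof (induction K)
  case (collapse \<sigma> K w)
  show ?case
  proof (cases "\<sigma> = {}")
    case True
    then show ?thesis using collapse.hyps(2) by auto
  next
    case False
    then show ?thesis using collapse.IH collapse.prems by blast
  qed
qed simp

lemma polyhedron_nonempty:
  fixes K :: "'v::finite set set"
  assumes "{w} \<in> K" shows "polyhedron K \<noteq> {}"
proof -
  have "(\<lambda>v. if v = w then 1 else 0) \<in> polyhedron K" using assms by (simp add: polyhedron_def)
  then show ?thesis by blast
qed

text \<open>
  The vertex supplied by \<open>collapsible_imp_vertex\<close> guarantees that the subcomplex to be shrunk is
  nonempty; the sphere count is the alternating sum of face numbers.
\<close>

theorem matroid_wedge_of_spheres:
  fixes K :: "'v::finite set set"
  assumes K: "matroid K" and B: "B \<in> K" "card B = d + 1"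
    and dim: "\<And>\<tau>. \<tau> \<in> K \<Longrightarrow> card \<tau> \<le> d + 1"
  shows "\<exists>N. real N = (\<Sum>k\<le>d + 1. (-1) ^ (d + 1 + k) * real (card {\<tau> \<in> K. card \<tau> = k})) \<and>
    geometric_realization K homotopy_equivalent_space wedge_of_spheres N d"
proof -
  obtain H where H: "H \<subseteq> K" "\<forall>h\<in>H. card h = d + 1" "collapsible (K - H)"
    using matroid_collapsible_diff_bases[OF K B dim] by blast
  have down: "down_closed K" and "{} \<in> K" using K by (auto simp: matroid_def)
  then have empty: "{} \<in> K - H" using H(2) by fastforce
  have down': "down_closed (K - H)" using down H(2) dim by (intro down_closed_diff_facets) auto
  obtain w where "{w} \<in> K - H" using collapsible_imp_vertex[OF H(3) empty] by blast
  then have "polyhedron (K - H) \<noteq> {}" by (rule polyhedron_nonempty)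
  moreover have "contractible (polyhedron (K - H))"
    by (rule collapsible_imp_contractible[OF H(3) down' empty])
  ultimately have "geometric_realization K homotopy_equivalent_space wedge_of_spheres (card H) d"
    unfolding geometric_realization_eq
    using H(2) by (intro complex_minus_contractible_wedge[OF down H(1) _ dim]) auto
  then show ?thesis using card_removed_bases[OF H dim] by blast
qed

lemma matroid_link:
  fixes M :: "'v::finite set set"
  assumes M: "matroid M" and \<sigma>: "\<sigma> \<in> M"
  shows "matroid (link M \<sigma>)"
  unfolding matroid_def down_closed_def
proof (intro conjI ballI allI impI)
  show "{} \<in> link M \<sigma>" using \<sigma> by (simp add: link_def)
next
  fix X Y assume "X \<in> link M \<sigma>" "Y \<subseteq> X"
  moreover have "down_closed M" using M by (simp add: matroid_def)
  ultimately show "Y \<in> link M \<sigma>"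
    using down_closedD[of M "\<sigma> \<union> X" "\<sigma> \<union> Y"] by (auto simp: link_def)
next
  fix X Y assume X: "X \<in> link M \<sigma>" and Y: "Y \<in> link M \<sigma>" and "card X < card Y"
  then have "card (\<sigma> \<union> X) < card (\<sigma> \<union> Y)" by (simp add: link_def card_Un_disjoint)
  then obtain x where "x \<in> \<sigma> \<union> Y" "x \<notin> \<sigma> \<union> X" "insert x (\<sigma> \<union> X) \<in> M"
    using matroid_augment[OF M, of "\<sigma> \<union> X" "\<sigma> \<union> Y"] X Y by (auto simp: link_def)
  then show "\<exists>x\<in>Y - X. insert x X \<in> link M \<sigma>" using X by (auto simp: link_def)
qed

text \<open>
  Double counting of the pairs consisting of a face of size \<open>k + 1\<close> and one of its elements.
\<close>

lemma card_faces_Suc: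
  fixes K :: "'v::finite set set"
  assumes K: "down_closed K"
    and c: "\<And>\<tau>. \<tau> \<in> K \<Longrightarrow> card \<tau> = k \<Longrightarrow> real (card {v. v \<notin> \<tau> \<and> insert v \<tau> \<in> K}) = c"
  shows "real (card {\<tau> \<in> K. card \<tau> = Suc k}) * real (Suc k) = real (card {\<tau> \<in> K. card \<tau> = k}) * c"
proof -
  let ?F = "\<lambda>k. {\<tau> \<in> K. card \<tau> = k}" and ?ext = "\<lambda>\<tau>. {v. v \<notin> \<tau> \<and> insert v \<tau> \<in> K}"
  have "bij_betw (\<lambda>(\<tau>, v). (insert v \<tau>, v)) (Sigma (?F k) ?ext) (Sigma (?F (Suc k)) (\<lambda>\<tau>. \<tau>))"
  proof (rule bij_betw_byWitness[where f' = "\<lambda>(\<tau>, v). (\<tau> - {v}, v)"])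
    show "(\<lambda>(\<tau>, v). (\<tau> - {v}, v)) ` Sigma (?F (Suc k)) (\<lambda>\<tau>. \<tau>) \<subseteq> Sigma (?F k) ?ext"
      using down_closedD[OF K] by (auto simp: insert_absorb)
  qed (auto simp: insert_absorb)
  then have "card (Sigma (?F k) ?ext) = card (Sigma (?F (Suc k)) (\<lambda>\<tau>. \<tau>))" by (rule bij_betw_same_card)
  then have "(\<Sum>\<tau>\<in>?F k. card (?ext \<tau>)) = (\<Sum>\<tau>\<in>?F (Suc k). card \<tau>)"
    by (subst (asm) (1 2) card_SigmaI) simp_all
  then have eq: "(\<Sum>\<tau>\<in>?F k. real (card (?ext \<tau>))) = (\<Sum>\<tau>\<in>?F (Suc k). real (card \<tau>))"
    unfolding of_nat_sum[symmetric] by (rule arg_cong)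
  have "(\<Sum>\<tau>\<in>?F k. real (card (?ext \<tau>))) = (\<Sum>\<tau>\<in>?F k. c)"
    by (rule sum.cong[OF refl]) (rule c, simp_all)
  moreover have "(\<Sum>\<tau>\<in>?F (Suc k). real (card \<tau>)) = (\<Sum>\<tau>\<in>?F (Suc k). real (Suc k))"
    by (rule sum.cong) simp_all
  ultimately show ?thesis using eq by (simp only: sum_constant)
qed

lemma card_faces:
  fixes K :: "'v::finite set set"
  assumes K: "down_closed K" "{} \<in> K"
    and c: "\<And>\<tau>. \<tau> \<in> K \<Longrightarrow> real (card {v. v \<notin> \<tau> \<and> insert v \<tau> \<in> K}) = c (card \<tau>)"
  shows "real (card {\<tau> \<in> K. card \<tau> = k}) = (\<Prod>j<k. c j) / fact k"
proof (induction k)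
  case 0
  have "{\<tau> \<in> K. card \<tau> = 0} = {{}}" using K(2) by auto
  then show ?case by simp
next
  case (Suc k)
  have "real (card {\<tau> \<in> K. card \<tau> = Suc k}) * real (Suc k)
      = real (card {\<tau> \<in> K. card \<tau> = k}) * c k"
    using c by (intro card_faces_Suc[OF K(1)]) simp
  moreover have "real (Suc k) \<noteq> 0" by simp
  ultimately have "real (card {\<tau> \<in> K. card \<tau> = Suc k}) = (\<Prod>j<k. c j) / fact k * c k / real (Suc k)"
    unfolding Suc.IH by (intro iffD2[OF nonzero_eq_divide_eq])
  then show ?case
    unfolding prod.lessThan_Suc fact_Suc
    by (simp only: times_divide_eq_left divide_divide_eq_left mult.commute[of "fact k"])
qed

text \<open>
  The hypothesis \<open>ext\<close> covers both complexes of the theorem: with \<open>q = 1\<close> it counts the vectors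
  outside the span of \<open>\<tau>\<close>, and with \<open>q = p - 1\<close> the lines not contained in it. An extension of
  a face \<open>\<tau>\<close> in the link is an extension of \<open>\<sigma> \<union> \<tau>\<close> in \<open>M\<close>, which shifts the exponent
  by \<open>m + 1\<close>.
\<close>

lemma link_wedge_of_spheres:
  fixes M :: "'v::finite set set" and p q :: real
  assumes M: "matroid M" and \<sigma>: "\<sigma> \<in> M" "card \<sigma> = m + 1"
    and B: "B \<in> M" "card B = n" and dim: "\<And>\<tau>. \<tau> \<in> M \<Longrightarrow> card \<tau> \<le> n"
    and nm: "n > 1" "m \<le> n - 2" and q: "q \<noteq> 0"
    and ext: "\<And>\<tau>. \<tau> \<in> M \<Longrightarrow> q * real (card {v. v \<notin> \<tau> \<and> insert v \<tau> \<in> M}) = p ^ n - p ^ card \<tau>"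
  shows "\<exists>N. real N = (-1) ^ (n - m - 1) + (\<Sum>i = 0..n - m - 2. (-1) ^ (n - m - i) *
        ((\<Prod>j = m + 1..m + i + 1. p ^ n - p ^ j) / (q ^ (i + 1) * fact (i + 1)))) \<and>
      geometric_realization (link M \<sigma>) homotopy_equivalent_space wedge_of_spheres N (n - m - 2)"
proof -
  let ?L = "link M \<sigma>"
  define d where "d = n - m - 2"
  have n: "n = m + d + 2" using nm by (simp add: d_def)
  have L: "matroid ?L" by (rule matroid_link[OF M \<sigma>(1)])
  have down: "down_closed ?L" "{} \<in> ?L" using L by (auto simp: matroid_def)
  have card_L: "card (\<sigma> \<union> \<tau>) = m + 1 + card \<tau>" if "\<tau> \<in> ?L" for \<tau>
    using that \<sigma>(2) by (simp add: link_def card_Un_disjoint)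
  have dim_L: "card \<tau> \<le> d + 1" if "\<tau> \<in> ?L" for \<tau>
    using card_L[OF that] dim[of "\<sigma> \<union> \<tau>"] that by (simp add: link_def n)
  obtain C where C: "C \<in> M" "\<sigma> \<subseteq> C" "card C = n"
    using matroid_extend_to_rank[OF M \<sigma>(1) B(1)] dim[OF \<sigma>(1)] B(2) by metis
  have "C - \<sigma> \<in> ?L" "card (C - \<sigma>) = d + 1"
    using C \<sigma>(2) by (auto simp: link_def Un_absorb1 card_Diff_subset n)
  then obtain N where N: "real N = (\<Sum>k\<le>d + 1. (-1) ^ (d + 1 + k) * real (card {\<tau> \<in> ?L. card \<tau> = k}))"
      "geometric_realization ?L homotopy_equivalent_space wedge_of_spheres N d"
    using matroid_wedge_of_spheres[OF L _ _ dim_L] by blast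
  define c where "c k = (p ^ n - p ^ (m + 1 + k)) / q" for k
  have c: "real (card {v. v \<notin> \<tau> \<and> insert v \<tau> \<in> ?L}) = c (card \<tau>)" if \<tau>: "\<tau> \<in> ?L" for \<tau>
  proof -
    have "{v. v \<notin> \<tau> \<and> insert v \<tau> \<in> ?L} = {v. v \<notin> \<sigma> \<union> \<tau> \<and> insert v (\<sigma> \<union> \<tau>) \<in> M}"
      using \<tau> by (auto simp: link_def)
    moreover have "\<sigma> \<union> \<tau> \<in> M" using \<tau> by (simp add: link_def)
    ultimately show ?thesis using ext[of "\<sigma> \<union> \<tau>"] q card_L[OF \<tau>] by (simp add: c_def field_simps)
  qed
  have faces: "real (card {\<tau> \<in> ?L. card \<tau> = k}) = (\<Prod>j<k. c j) / fact k" for k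
    by (rule card_faces[OF down c])
  have prod_c: "(\<Prod>j<Suc i. c j) = (\<Prod>j = m + 1..m + i + 1. p ^ n - p ^ j) / q ^ (i + 1)" for i
    by (induction i) (simp_all add: c_def)
  have "real N = (-1) ^ (d + 1) + (\<Sum>i\<le>d. (-1) ^ (d + 1 + Suc i) * ((\<Prod>j<Suc i. c j) / fact (Suc i)))"
    unfolding N(1) faces by (simp add: sum.atMost_Suc_shift del: sum.atMost_Suc prod.lessThan_Suc)
  also have "(\<Sum>i\<le>d. (-1) ^ (d + 1 + Suc i) * ((\<Prod>j<Suc i. c j) / fact (Suc i)))
      = (\<Sum>i = 0..d. (-1) ^ (n - m - i) *
        ((\<Prod>j = m + 1..m + i + 1. p ^ n - p ^ j) / (q ^ (i + 1) * fact (i + 1))))"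
  proof (rule sum.cong)
    fix i assume "i \<in> {0..d}"
    then have "d + 1 + Suc i = (n - m - i) + 2 * i" by (simp add: n)
    then have "(-1 :: real) ^ (d + 1 + Suc i) = (-1) ^ (n - m - i)"
      by (simp only: power_add power_mult) simp
    then show "(-1) ^ (d + 1 + Suc i) * ((\<Prod>j<Suc i. c j) / fact (Suc i)) = (-1) ^ (n - m - i) *
        ((\<Prod>j = m + 1..m + i + 1. p ^ n - p ^ j) / (q ^ (i + 1) * fact (i + 1)))"
      unfolding prod_c by simp
  qed (simp add: atMost_atLeast0)
  finally have "real N = (-1) ^ (n - m - 1) + (\<Sum>i = 0..n - m - 2. (-1) ^ (n - m - i) *
        ((\<Prod>j = m + 1..m + i + 1. p ^ n - p ^ j) / (q ^ (i + 1) * fact (i + 1))))"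
    by (simp add: n)
  then show ?thesis using N(2) unfolding d_def by blast
qed

text \<open>
  A number of extensions cannot be negative, which bounds the size of a face, and a maximal face has
  no extension at all, which forces its size to be \<open>n\<close>.
\<close>

lemma rank_from_extension_counts:
  fixes M :: "'v::finite set set" and p q :: real
  assumes M: "matroid M" and q: "0 < q" and p: "1 < p"
    and ext: "\<And>\<tau>. \<tau> \<in> M \<Longrightarrow> q * real (card {v. v \<notin> \<tau> \<and> insert v \<tau> \<in> M}) = p ^ n - p ^ card \<tau>"
  shows "\<tau> \<in> M \<Longrightarrow> card \<tau> \<le> n" and "\<exists>B\<in>M. card B = n"
proof -
  show le: "card \<tau> \<le> n" if "\<tau> \<in> M" for \<tau>
  proof -
    have "0 \<le> p ^ n - p ^ card \<tau>" using ext[OF that] q by (metis less_imp_le mult_nonneg_nonneg of_nat_0_le_iff)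
    then show ?thesis using p by simp
  qed
  have "M \<noteq> {}" using M by (auto simp: matroid_def)
  then have "\<exists>B\<in>M. \<forall>\<tau>\<in>M. B \<subseteq> \<tau> \<longrightarrow> B = \<tau>" by (intro finite_has_maximal) auto
  then obtain B where B: "B \<in> M" "\<forall>\<tau>\<in>M. B \<subseteq> \<tau> \<longrightarrow> B = \<tau>" by blast
  have none: "{v. v \<notin> B \<and> insert v B \<in> M} = {}" using B(2) by blast
  have "p ^ n - p ^ card B = 0" using ext[OF B(1)] unfolding none by simp
  then have "p ^ n = p ^ card B" by simp
  then have "card B = n" using p by (simp add: power_inject_exp)
  then show "\<exists>B\<in>M. card B = n" using B(1) by blast
qed

section \<open>Independent vectors and lines over a finite field\<close>

text \<open>
  A vector of the span of \<open>insert b B\<close> is uniquely a multiple of \<open>b\<close> plus a vector of the span of \<open>B\<close>.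
\<close>

lemma card_span_independent:
  fixes B :: "('a::{field,finite} ^ 'n) set"
  assumes "vec.independent B"
  shows "card (vec.span B) = CARD('a) ^ card B"
proof -
  have "finite B" by simp
  then show ?thesis using assms
  proof (induction B rule: finite_induct)
    case empty
    then show ?case by simp
  next
    case (insert b B)
    then have b: "b \<notin> vec.span B" and B: "vec.independent B"
      using vec.independent_insert[of b B] by auto
    let ?f = "\<lambda>(k, x). k *s b + x"
    have "vec.span (insert b B) = ?f ` (UNIV \<times> vec.span B)"
    proof (intro equalityI subsetI)
      fix x assume "x \<in> vec.span (insert b B)"
      then obtain k where "x - k *s b \<in> vec.span B" using vec.span_breakdown_eq by blast
      then show "x \<in> ?f ` (UNIV \<times> vec.span B)" by (intro image_eqI[of _ _ "(k, x - k *s b)"]) auto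
    next
      fix x assume "x \<in> ?f ` (UNIV \<times> vec.span B)"
      then obtain k y where "x = k *s b + y" "y \<in> vec.span B" by auto
      then have "x - k *s b \<in> vec.span B" by simp
      then show "x \<in> vec.span (insert b B)" using vec.span_breakdown_eq by blast
    qed
    moreover have "inj_on ?f (UNIV \<times> vec.span B)"
    proof (rule inj_onI, clarify)
      fix k x l y assume *: "x \<in> vec.span B" "y \<in> vec.span B" "k *s b + x = l *s b + y"
      have eq: "(k - l) *s b = y - x" using *(3) by (simp add: vec.scale_left_diff_distrib algebra_simps)
      have "k = l"
      proof (rule ccontr)
        assume "k \<noteq> l"
        then have "inverse (k - l) *s ((k - l) *s b) = b" by (subst vec.scale_scale) simp
        then have "b = inverse (k - l) *s (y - x)" unfolding eq by simp
        moreover have "inverse (k - l) *s (y - x) \<in> vec.span B"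
          using * by (intro vec.span_scale vec.span_diff)
        ultimately show False using b by simp
      qed
      then show "k = l \<and> x = y" using *(3) by simp
    qed
    ultimately have "card (vec.span (insert b B)) = CARD('a) * card (vec.span B)"
      by (simp add: card_image card_cartesian_product)
    then show ?case using insert.IH[OF B] insert.hyps by simp
  qed
qed

lemma card_span:
  fixes S :: "('a::{field,finite} ^ 'n) set"
  shows "card (vec.span S) = CARD('a) ^ vec.dim S"
proof -
  obtain B where B: "B \<subseteq> S" "vec.independent B" "S \<subseteq> vec.span B" "card B = vec.dim S"
    using vec.basis_exists by blast
  then have "vec.span B = vec.span S"
    by (metis vec.span_mono vec.span_span subset_antisym)
  then show ?thesis using card_span_independent[OF B(2)] B(4) by simp
qed

lemma card_UNIV_vec: "card (UNIV :: ('a::{field,finite} ^ 'n) set) = CARD('a) ^ CARD('n)"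
  using card_span[of "UNIV :: ('a ^ 'n) set"] by (simp add: vec.dim_UNIV card_cart_basis)

lemma real_card_Compl:
  fixes A :: "'v::finite set"
  shows "real (card (UNIV - A)) = real CARD('v) - real (card A)"
  by (simp add: card_Diff_subset of_nat_diff[OF card_mono])

lemma matroid_unimodular_complex: "matroid (unimodular_complex :: ('a::{field,finite} ^ 'n) set set)"
  unfolding matroid_def down_closed_def
proof (intro conjI ballI allI impI)
  show "{} \<in> (unimodular_complex :: ('a ^ 'n) set set)" 
    by (simp add: unimodular_complex_def vec.independent_empty)
  show "\<rho> \<in> unimodular_complex" if "\<tau> \<in> unimodular_complex" "\<rho> \<subseteq> \<tau>" for \<tau> \<rho> :: "('a ^ 'n) set"
    using that vec.independent_mono by (auto simp: unimodular_complex_def)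
  fix X Y :: "('a ^ 'n) set"
  assume X: "X \<in> unimodular_complex" and Y: "Y \<in> unimodular_complex" and "card X < card Y"
  then have "\<not> Y \<subseteq> vec.span X"
    using vec.independent_span_bound[of X Y] by (auto simp: unimodular_complex_def)
  then obtain x where x: "x \<in> Y" "x \<notin> vec.span X" by blast
  then have "x \<notin> X" using vec.span_base by blast
  then show "\<exists>x\<in>Y - X. insert x X \<in> unimodular_complex"
    using x X vec.independent_insertI by (auto simp: unimodular_complex_def)
qed

lemma unimodular_extensions:
  fixes \<tau> :: "('a::{field,finite} ^ 'n) set"
  assumes "\<tau> \<in> unimodular_complex"
  shows "{v. v \<notin> \<tau> \<and> insert v \<tau> \<in> unimodular_complex} = UNIV - vec.span \<tau>"
proof -
  have \<tau>: "vec.independent \<tau>" using assms by (simp add: unimodular_complex_def)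
  have "v \<notin> \<tau> \<and> vec.independent (insert v \<tau>) \<longleftrightarrow> v \<notin> vec.span \<tau>" for v
    using \<tau> vec.span_base[of v \<tau>] by (cases "v \<in> \<tau>") (auto simp: vec.independent_insert)
  then show ?thesis by (auto simp: unimodular_complex_def)
qed

lemma card_unimodular_extensions:
  fixes \<tau> :: "('a::{field,finite} ^ 'n) set"
  assumes "\<tau> \<in> unimodular_complex"
  shows "real (card {v. v \<notin> \<tau> \<and> insert v \<tau> \<in> unimodular_complex})
    = real CARD('a) ^ CARD('n) - real CARD('a) ^ card \<tau>"
proof -
  have \<tau>: "vec.independent \<tau>" using assms by (simp add: unimodular_complex_def)
  show ?thesis
    unfolding unimodular_extensions[OF assms] real_card_Compl card_span_independent[OF \<tau>] card_UNIV_vec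
    by simp
qed

lemma line_span_singleton:
  assumes "v \<noteq> 0" shows "vec.span {v} \<in> lines"
  using assms by (simp add: lines_def)

lemma line_eq_span:
  fixes L :: "('a::field ^ 'n) set"
  assumes "L \<in> lines" "v \<in> L" "v \<noteq> 0"
  shows "L = vec.span {v}"
proof (rule vec.subspace_dim_equal[symmetric])
  show "vec.subspace L" using assms(1) by (simp add: lines_def)
  then show "vec.span {v} \<subseteq> L" using assms(2) by (intro vec.span_minimal) auto
  show "vec.dim L \<le> vec.dim (vec.span {v})" using assms by (simp add: lines_def)
qed simp

lemma line_obtain_vector:
  fixes L :: "('a::field ^ 'n) set"
  assumes "L \<in> lines"
  obtains v where "v \<in> L" "v \<noteq> 0" "L = vec.span {v}"
proof -
  have "vec.dim L \<noteq> 0" using assms by (simp add: lines_def)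
  then have "\<not> L \<subseteq> {0}" by simp
  then obtain v where "v \<in> L" "v \<noteq> 0" by blast
  then show ?thesis using that line_eq_span[OF assms] by blast
qed

text \<open>
  A line behaves like any of its nonzero vectors, so rank computations for lines reduce to
  \<open>vec.dim_insert\<close>.
\<close>

lemma dim_Union_insert_line:
  fixes S :: "('a::field ^ 'n) set set"
  assumes "L \<in> lines"
  shows "vec.dim (\<Union>(insert L S)) = vec.dim (\<Union>S) + (if L \<subseteq> vec.span (\<Union>S) then 0 else 1)"
proof -
  obtain v where v: "v \<in> L" "L = vec.span {v}" using line_obtain_vector[OF assms] by metis
  have sub: "L \<subseteq> vec.span (\<Union>S) \<longleftrightarrow> v \<in> vec.span (\<Union>S)"
    using v vec.span_minimal[of "{v}" "vec.span (\<Union>S)"] by auto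
  have "vec.span (\<Union>(insert L S)) = vec.span (insert v (\<Union>S))"
  proof (intro equalityI vec.span_minimal vec.subspace_span)
    have "L \<subseteq> vec.span (insert v (\<Union>S))" unfolding v(2) by (intro vec.span_mono) auto
    moreover have "\<Union>S \<subseteq> vec.span (insert v (\<Union>S))"
      using vec.span_superset[of "insert v (\<Union>S)"] by blast
    ultimately show "\<Union>(insert L S) \<subseteq> vec.span (insert v (\<Union>S))" by simp
    show "insert v (\<Union>S) \<subseteq> vec.span (\<Union>(insert L S))"
      using v(1) vec.span_superset[of "\<Union>(insert L S)"] by blast
  qed
  then have "vec.dim (\<Union>(insert L S)) = vec.dim (insert v (\<Union>S))" by (rule vec.span_eq_dim)
  then show ?thesis unfolding sub by (simp add: vec.dim_insert)
qed

lemma dim_Union_lines_le: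
  fixes A :: "('a::field ^ 'n) set set"
  assumes "finite B" "B \<subseteq> lines"
  shows "vec.dim (\<Union>(A \<union> B)) \<le> vec.dim (\<Union>A) + card B"
  using assms
proof (induction B rule: finite_induct)
  case (insert L B)
  then have "vec.dim (\<Union>(insert L (A \<union> B))) \<le> vec.dim (\<Union>(A \<union> B)) + 1"
    using dim_Union_insert_line[of L "A \<union> B"] by auto
  then show ?case using insert by simp
qed simp

lemma line_complex_iff:
  fixes S :: "('a::{field,finite} ^ 'n) set set"
  shows "S \<in> line_complex \<longleftrightarrow> S \<subseteq> lines \<and> vec.dim (\<Union>S) = card S"
  by (simp add: line_complex_def)

lemma insert_in_line_complex_iff:
  fixes S :: "('a::{field,finite} ^ 'n) set set"
  assumes "S \<in> line_complex" "L \<notin> S"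
  shows "insert L S \<in> line_complex \<longleftrightarrow> L \<in> lines \<and> \<not> L \<subseteq> vec.span (\<Union>S)"
proof (cases "L \<in> lines")
  case True
  then show ?thesis
    using assms dim_Union_insert_line[OF True, of S] by (auto simp: line_complex_iff simp del: Union_insert)
qed (simp add: line_complex_iff)

text \<open>
  A subfamily of an independent family of lines is independent since every further line raises the
  dimension by at most 1. For augmentation, some line of the larger family leaves the span of the
  smaller one by dimension.
\<close>

lemma matroid_line_complex: "matroid (line_complex :: ('a::{field,finite} ^ 'n) set set set)"
  unfolding matroid_def down_closed_def
proof (intro conjI ballI allI impI)
  show "{} \<in> (line_complex :: ('a ^ 'n) set set set)" by (simp add: line_complex_iff)
next
  fix \<tau> \<rho> :: "('a ^ 'n) set set" assume \<tau>: "\<tau> \<in> line_complex" and \<rho>: "\<rho> \<subseteq> \<tau>"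
  then have lines: "\<rho> \<subseteq> lines" "\<tau> - \<rho> \<subseteq> lines" by (auto simp: line_complex_iff)
  have "card \<tau> = vec.dim (\<Union>(\<rho> \<union> (\<tau> - \<rho>)))"
    using \<tau> \<rho> by (simp add: line_complex_iff Un_absorb1)
  also have "\<dots> \<le> vec.dim (\<Union>\<rho>) + card (\<tau> - \<rho>)" using lines by (intro dim_Union_lines_le) auto
  finally have "card \<rho> \<le> vec.dim (\<Union>\<rho>)"
    using \<rho> card_mono[OF _ \<rho>] by (simp add: card_Diff_subset)
  moreover have "vec.dim (\<Union>\<rho>) \<le> card \<rho>" using dim_Union_lines_le[of \<rho> "{}"] lines by simp
  ultimately show "\<rho> \<in> line_complex" using lines by (simp add: line_complex_iff)
next
  fix X Y :: "('a ^ 'n) set set"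
  assume X: "X \<in> line_complex" and Y: "Y \<in> line_complex" and less: "card X < card Y"
  have "\<not> \<Union>Y \<subseteq> vec.span (\<Union>X)"
  proof
    assume "\<Union>Y \<subseteq> vec.span (\<Union>X)"
    then have "vec.dim (\<Union>Y) \<le> vec.dim (vec.span (\<Union>X))" by (rule vec.dim_subset)
    then show False using X Y less by (simp add: line_complex_iff)
  qed
  then obtain L where L: "L \<in> Y" "\<not> L \<subseteq> vec.span (\<Union>X)" by blast
  then have "L \<notin> X" using vec.span_base[of _ "\<Union>X"] by blast
  moreover have "L \<in> lines" using L Y by (auto simp: line_complex_iff)
  ultimately show "\<exists>L\<in>Y - X. insert L X \<in> line_complex"
    using insert_in_line_complex_iff[OF X] L by blast
qed

text \<open>
  The vectors outside a subspace are partitioned by the punctured lines not contained in it.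
\<close>

lemma card_lines_not_within:
  fixes S :: "('a::{field,finite} ^ 'n) set"
  shows "(CARD('a) - 1) * card {L \<in> lines. \<not> L \<subseteq> vec.span S} = card (UNIV - vec.span S)"
proof -
  let ?V = "vec.span S" and ?\<L> = "{L \<in> lines. \<not> L \<subseteq> vec.span S}"
  have not_in: "x \<notin> ?V" if "L \<in> lines" "\<not> L \<subseteq> ?V" "x \<in> L" "x \<noteq> 0" for L x
  proof
    assume "x \<in> ?V"
    then have "vec.span {x} \<subseteq> ?V" by (intro vec.span_minimal vec.subspace_span) simp
    then show False using line_eq_span[OF that(1,3,4)] that(2) by simp
  qed
  have "UNIV - ?V = (\<Union>L\<in>?\<L>. L - {0})"
  proof (intro equalityI subsetI)
    fix x assume x: "x \<in> UNIV - ?V"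
    then have "x \<noteq> 0" using vec.span_zero by blast
    moreover have x_in: "x \<in> vec.span {x}" by (simp add: vec.span_base)
    moreover have "\<not> vec.span {x} \<subseteq> ?V" using x x_in by blast
    ultimately show "x \<in> (\<Union>L\<in>?\<L>. L - {0})"
      using line_span_singleton[of x] by (intro UN_I[of "vec.span {x}"]) simp_all
  next
    fix x assume "x \<in> (\<Union>L\<in>?\<L>. L - {0})"
    then obtain L where "L \<in> lines" "\<not> L \<subseteq> ?V" "x \<in> L" "x \<noteq> 0" by blast
    from not_in[OF this] show "x \<in> UNIV - ?V" by simp
  qed
  moreover have "card (\<Union>L\<in>?\<L>. L - {0}) = (\<Sum>L\<in>?\<L>. card (L - {0}))"
  proof (rule card_UN_disjoint)
    show "\<forall>L\<in>?\<L>. \<forall>L'\<in>?\<L>. L \<noteq> L' \<longrightarrow> (L - {0}) \<inter> (L' - {0}) = {}"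
    proof (intro ballI impI equals0I)
      fix L L' x assume "L \<in> ?\<L>" "L' \<in> ?\<L>" "L \<noteq> L'" and x: "x \<in> (L - {0}) \<inter> (L' - {0})"
      then have "L = vec.span {x}" "L' = vec.span {x}" using line_eq_span[of _ x] by simp_all
      then show False using \<open>L \<noteq> L'\<close> by simp
    qed
  qed simp_all
  moreover have "card (L - {0}) = CARD('a) - 1" if "L \<in> ?\<L>" for L
  proof -
    have L: "L \<in> lines" using that by simp
    then obtain v where v: "v \<in> L" "v \<noteq> 0" "L = vec.span {v}" by (rule line_obtain_vector)
    have "card L = CARD('a) ^ vec.dim {v}" unfolding v(3) by (rule card_span)
    then have "card L = CARD('a)" using v(2) by simp
    moreover have "0 \<in> L" using L by (auto simp: lines_def intro: vec.subspace_0)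
    ultimately show ?thesis by (simp add: card_Diff_singleton)
  qed
  ultimately show ?thesis by (simp add: mult.commute)
qed

lemma card_line_extensions:
  fixes \<tau> :: "('a::{field,finite} ^ 'n) set set"
  assumes "\<tau> \<in> line_complex"
  shows "(real CARD('a) - 1) * real (card {L. L \<notin> \<tau> \<and> insert L \<tau> \<in> line_complex})
    = real CARD('a) ^ CARD('n) - real CARD('a) ^ card \<tau>"
proof -
  have "{L. L \<notin> \<tau> \<and> insert L \<tau> \<in> line_complex} = {L \<in> lines. \<not> L \<subseteq> vec.span (\<Union>\<tau>)}"
  proof -
    have "L \<subseteq> vec.span (\<Union>\<tau>)" if "L \<in> \<tau>" for L
      using that vec.span_superset[of "\<Union>\<tau>"] by blast
    then show ?thesis using insert_in_line_complex_iff[OF assms] by (intro Collect_cong) metis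
  qed
  moreover have "real CARD('a) - 1 = real (CARD('a) - 1)"
    by (simp add: of_nat_diff Suc_leI)
  ultimately have "(real CARD('a) - 1) * real (card {L. L \<notin> \<tau> \<and> insert L \<tau> \<in> line_complex})
      = real (card (UNIV - vec.span (\<Union>\<tau>)))"
    using card_lines_not_within[of "\<Union>\<tau>"] by (simp only: of_nat_mult[symmetric])
  also have "\<dots> = real (card (UNIV :: ('a ^ 'n) set)) - real (card (vec.span (\<Union>\<tau>)))"
    by (rule real_card_Compl)
  also have "\<dots> = real CARD('a) ^ CARD('n) - real CARD('a) ^ card \<tau>"
    using assms by (simp add: card_UNIV_vec card_span line_complex_iff)
  finally show ?thesis .
qed


theorem theorem3p5:
  fixes p n m :: nat
  assumes "prime p" and "CARD('a::{field,finite}) = p" and "CARD('n::finite) = n"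
    and "n > 1" and "m \<le> n - 2"
  shows "(\<forall>\<sigma> \<in> (unimodular_complex :: ('a ^ 'n) set set). card \<sigma> = m + 1 \<longrightarrow>
            (\<exists>N::nat. real N = A_number m n p \<and>
               geometric_realization (link unimodular_complex \<sigma>)
                 homotopy_equivalent_space wedge_of_spheres N (n - m - 2))) \<and>
         (\<forall>\<sigma> \<in> (line_complex :: ('a ^ 'n) set set set). card \<sigma> = m + 1 \<longrightarrow>
            (\<exists>N::nat. real N = B_number m n p \<and>
               geometric_realization (link line_complex \<sigma>)
                 homotopy_equivalent_space wedge_of_spheres N (n - m - 2)))"
proof -
  have p: "1 < real p" using prime_gt_1_nat[OF assms(1)] by simp
  show ?thesis
  proof (intro conjI ballI impI)
    fix \<sigma> :: "('a ^ 'n) set" assume \<sigma>: "\<sigma> \<in> unimodular_complex" "card \<sigma> = m + 1"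
    have M: "matroid (unimodular_complex :: ('a ^ 'n) set set)" by (rule matroid_unimodular_complex)
    have ext: "1 * real (card {v. v \<notin> \<tau> \<and> insert v \<tau> \<in> unimodular_complex}) = real p ^ n - real p ^ card \<tau>"
      if "\<tau> \<in> unimodular_complex" for \<tau> :: "('a ^ 'n) set"
      using card_unimodular_extensions[OF that] assms(2,3) by simp
    note dim = rank_from_extension_counts[OF M zero_less_one p ext]
    obtain B where "B \<in> (unimodular_complex :: ('a ^ 'n) set set)" "card B = n" using dim(2) by blast
    from link_wedge_of_spheres[OF M \<sigma> this dim(1) assms(4,5) one_neq_zero ext]
    show "\<exists>N::nat. real N = A_number m n p \<and> geometric_realization (link unimodular_complex \<sigma>)
        homotopy_equivalent_space wedge_of_spheres N (n - m - 2)"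
      by (simp add: A_number_def)
  next
    fix \<sigma> :: "('a ^ 'n) set set" assume \<sigma>: "\<sigma> \<in> line_complex" "card \<sigma> = m + 1"
    have M: "matroid (line_complex :: ('a ^ 'n) set set set)" by (rule matroid_line_complex)
    have q: "0 < real p - 1" using p by simp
    then have q0: "real p - 1 \<noteq> 0" by simp
    have ext: "(real p - 1) * real (card {L. L \<notin> \<tau> \<and> insert L \<tau> \<in> line_complex}) = real p ^ n - real p ^ card \<tau>"
      if "\<tau> \<in> line_complex" for \<tau> :: "('a ^ 'n) set set"
      using card_line_extensions[OF that] assms(2,3) by simp
    note dim = rank_from_extension_counts[OF M q p ext]
    obtain B where "B \<in> (line_complex :: ('a ^ 'n) set set set)" "card B = n" using dim(2) by blast
    from link_wedge_of_spheres[OF M \<sigma> this dim(1) assms(4,5) q0 ext]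
    show "\<exists>N::nat. real N = B_number m n p \<and> geometric_realization (link line_complex \<sigma>)
        homotopy_equivalent_space wedge_of_spheres N (n - m - 2)"
      by (simp add: B_number_def)
  qed
qed

end
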